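(* Let $\mathcal{W}$ be the Lie algebra $W(2,2)$, and let $M$ be a $U(\mathcal{W})$-module whose restriction to $U(\mathbb{C}L_0)$ is free of rank $1$. Then $M\cong\Omega_{\mathcal{W}}(\lambda,\alpha)$ as $\mathcal{W}$-modules for some $\alpha\in\mathbb{C}$ and $\lambda\in\mathbb{C}^*$. Moreover, $M$ is simple if and only if $M\cong\Omega_{\mathcal{W}}(\lambda,\alpha)$ for some $\lambda,\alpha\in\mathbb{C}^*$.
   Context: $\mathbb{C}^*=\mathbb{C}\setminus\{0\}$, and $U(\cdot)$ denotes the universal enveloping algebra. The Lie algebra $\mathcal{W}=W(2,2)$ is the complex Lie algebra with basis $\{L_n, W_n, C_1, C_2\mid n\in\mathbb{Z}\}$ and brackets, for all $m,n\in\mathbb{Z}$, $$[L_m,L_n]=(n-m)L_{m+n}+\delta_{m+n,0}\frac{m^3-m}{12}C_1,$$ $$[L_m,W_n]=(n-m)W_{m+n}+\delta_{m+n,0}\frac{m^3-m}{12}C_2,$$ $$[W_m,W_n]=0,$$ where $C_1,C_2$ are central. For $\lambda\in\mathbb{C}^*$ and $\alpha\in\mathbb{C}$, $\Omega_{\mathcal{W}}(\lambda,\alpha)$ is the $\mathcal{W}$-module with underlying space the polynomial algebra $\mathbb{C}[t]$ and action $$C_jf(t)=W_mf(t)=0,\qquad L_mf(t)=\lambda^m(t-m\alpha)f(t-m),$$ for $f(t)\in\mathbb{C}[t]$, $m\in\mathbb{Z}$, $j=1,2$. *)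

theory Defs
  imports
    "HOL-Library.Poly_Mapping"
    "HOL-Computational_Algebra.Polynomial"
    "HOL-Algebra.QuotRing"
    "HOL-Algebra.Module"
begin

section \<open>Left modules over a not necessarily commutative ring\<close>

text \<open>The library locale \<open>module\<close> requires a commutative ring. The multiplicative fields
  of the record type \<open>module\<close> play no role for modules.\<close>

locale left_module = R?: ring R + M?: abelian_group M for R (structure) and M (structure) +
  assumes smult_closed:
      "\<lbrakk>a \<in> carrier R; x \<in> carrier M\<rbrakk> \<Longrightarrow> a \<odot>\<^bsub>M\<^esub> x \<in> carrier M"
    and smult_l_distr:
      "\<lbrakk>a \<in> carrier R; b \<in> carrier R; x \<in> carrier M\<rbrakk> \<Longrightarrow>
        (a \<oplus>\<^bsub>R\<^esub> b) \<odot>\<^bsub>M\<^esub> x = a \<odot>\<^bsub>M\<^esub> x \<oplus>\<^bsub>M\<^esub> b \<odot>\<^bsub>M\<^esub> x"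
    and smult_r_distr:
      "\<lbrakk>a \<in> carrier R; x \<in> carrier M; y \<in> carrier M\<rbrakk> \<Longrightarrow>
        a \<odot>\<^bsub>M\<^esub> (x \<oplus>\<^bsub>M\<^esub> y) = a \<odot>\<^bsub>M\<^esub> x \<oplus>\<^bsub>M\<^esub> a \<odot>\<^bsub>M\<^esub> y"
    and smult_assoc:
      "\<lbrakk>a \<in> carrier R; b \<in> carrier R; x \<in> carrier M\<rbrakk> \<Longrightarrow>
        (a \<otimes>\<^bsub>R\<^esub> b) \<odot>\<^bsub>M\<^esub> x = a \<odot>\<^bsub>M\<^esub> (b \<odot>\<^bsub>M\<^esub> x)"
    and smult_one: "x \<in> carrier M \<Longrightarrow> \<one>\<^bsub>R\<^esub> \<odot>\<^bsub>M\<^esub> x = x"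

definition simple_module :: "('r, 's) ring_scheme \<Rightarrow> ('r, 'm, 't) module_scheme \<Rightarrow> bool" where
  "simple_module R M \<longleftrightarrow> left_module R M \<and> carrier M \<noteq> {\<zero>\<^bsub>M\<^esub>} \<and>
     (\<forall>N. submodule N R M \<longrightarrow> N = {\<zero>\<^bsub>M\<^esub>} \<or> N = carrier M)"

text \<open>\<open>{b}\<close> is a basis of \<open>M\<close>: every element of \<open>M\<close> is \<open>r b\<close> for exactly one \<open>r\<close>.\<close>

definition free_of_rank_one :: "('r, 's) ring_scheme \<Rightarrow> ('r, 'm, 't) module_scheme \<Rightarrow> bool" where
  "free_of_rank_one R M \<longleftrightarrow> left_module R M \<and>
     (\<exists>b\<in>carrier M. bij_betw (\<lambda>r. r \<odot>\<^bsub>M\<^esub> b) (carrier R) (carrier M))"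

definition restrict_scalars :: "('r \<Rightarrow> 'r) \<Rightarrow> ('r, 'm, 't) module_scheme \<Rightarrow> ('r, 'm, 't) module_scheme" where
  "restrict_scalars h M = M\<lparr>smult := (\<lambda>r x. h r \<odot>\<^bsub>M\<^esub> x)\<rparr>"


section \<open>Free associative algebras\<close>

text \<open>Words form a monoid under concatenation, written additively so that the
  convolution product of finitely supported functions is the product of the free algebra.\<close>

datatype 'g word = Word (letters: "'g list")

instantiation word :: (type) monoid_add
begin

definition zero_word :: "'a word" where "0 = Word []"

definition plus_word :: "'a word \<Rightarrow> 'a word \<Rightarrow> 'a word" where
  "v + w = Word (letters v @ letters w)"

instance by standard (simp_all add: zero_word_def plus_word_def)

end

definition free_algebra :: "'g set \<Rightarrow> ('g word \<Rightarrow>\<^sub>0 complex) ring" where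
  "free_algebra g =
     \<lparr>carrier = {p. \<forall>w\<in>Poly_Mapping.keys p. set (letters w) \<subseteq> g},
      monoid.mult = (*), one = 1, zero = 0, add = (+)\<rparr>"

definition gen :: "'g \<Rightarrow> 'g word \<Rightarrow>\<^sub>0 complex" where
  "gen x = Poly_Mapping.single (Word [x]) 1"

definition const :: "complex \<Rightarrow> 'g word \<Rightarrow>\<^sub>0 complex" where
  "const c = Poly_Mapping.single 0 c"

lemma ring_free_algebra: "ring (free_algebra g)"
proof -
  let ?F = "free_algebra g"
  have add: "p + q \<in> carrier ?F" if "p \<in> carrier ?F" "q \<in> carrier ?F" for p q
    using that keys_add[of p q] unfolding free_algebra_def by fastforce
  have mult: "p * q \<in> carrier ?F" if "p \<in> carrier ?F" "q \<in> carrier ?F" for p q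
  proof -
    have "set (letters w) \<subseteq> g" if "w \<in> Poly_Mapping.keys (p * q)" for w
    proof -
      obtain u v where "w = u + v" "u \<in> Poly_Mapping.keys p" "v \<in> Poly_Mapping.keys q"
        using \<open>w \<in> _\<close> keys_mult[of p q] by blast
      then show ?thesis
        using \<open>p \<in> carrier ?F\<close> \<open>q \<in> carrier ?F\<close> by (simp add: free_algebra_def plus_word_def)
    qed
    then show ?thesis by (simp add: free_algebra_def)
  qed
  have uminus: "- p \<in> carrier ?F" if "p \<in> carrier ?F" for p
    using that by (simp add: free_algebra_def in_keys_iff)
  have zero: "0 \<in> carrier ?F" and one: "1 \<in> carrier ?F"
    by (simp_all add: free_algebra_def zero_word_def)
  have ops: "monoid.mult ?F = (*)" "\<one>\<^bsub>?F\<^esub> = 1" "\<zero>\<^bsub>?F\<^esub> = 0" "add ?F = (+)"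
    by (simp_all add: free_algebra_def)
  show ?thesis
  proof (rule ringI)
    show "abelian_group ?F"
    proof (rule abelian_groupI)
      fix p assume "p \<in> carrier ?F"
      then show "\<exists>q\<in>carrier ?F. q \<oplus>\<^bsub>?F\<^esub> p = \<zero>\<^bsub>?F\<^esub>"
        by (intro bexI[of _ "- p"]) (simp_all add: ops uminus)
    qed (simp_all add: ops add zero add_ac)
    show "Group.monoid ?F"
      by (rule monoidI) (simp_all add: ops mult one mult.assoc)
  qed (simp_all add: ops ring_distribs)
qed


section \<open>Complex Lie algebras and universal enveloping algebras\<close>

definition complex_ring :: "complex ring" where
  "complex_ring = \<lparr>carrier = UNIV, monoid.mult = (*), one = 1, zero = 0, add = (+)\<rparr>"

record ('g, 'v) lie_rep = "(complex, 'v) module" +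
  act :: "'g \<Rightarrow> 'v \<Rightarrow> 'v"

locale lie_algebra = vector_space scale
  for scale :: "complex \<Rightarrow> 'g::ab_group_add \<Rightarrow> 'g" +
  fixes bracket :: "'g \<Rightarrow> 'g \<Rightarrow> 'g"
  assumes bracket_add_left: "bracket (x + y) z = bracket x z + bracket y z"
    and bracket_add_right: "bracket x (y + z) = bracket x y + bracket x z"
    and bracket_scale_left: "bracket (scale c x) y = scale c (bracket x y)"
    and bracket_scale_right: "bracket x (scale c y) = scale c (bracket x y)"
    and bracket_self: "bracket x x = 0"
    and jacobi: "bracket x (bracket y z) + bracket y (bracket z x) + bracket z (bracket x y) = 0"
begin

text \<open>For a Lie subalgebra \<open>g\<close>, the quotient of \<open>free_algebra g\<close> by the first two families of
  relations is the tensor algebra of the vector space \<open>g\<close>; the third family then gives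
  the universal enveloping algebra.\<close>

definition enveloping_relations :: "'g set \<Rightarrow> ('g word \<Rightarrow>\<^sub>0 complex) set" where
  "enveloping_relations g =
     {gen (x + y) - (gen x + gen y) | x y. x \<in> g \<and> y \<in> g} \<union>
     {gen (scale c x) - const c * gen x | c x. x \<in> g} \<union>
     {gen x * gen y - gen y * gen x - gen (bracket x y) | x y. x \<in> g \<and> y \<in> g}"

definition enveloping_ideal :: "'g set \<Rightarrow> ('g word \<Rightarrow>\<^sub>0 complex) set" where
  "enveloping_ideal g = genideal (free_algebra g) (enveloping_relations g)"

definition enveloping :: "'g set \<Rightarrow> ('g word \<Rightarrow>\<^sub>0 complex) set ring" where
  "enveloping g = free_algebra g Quot enveloping_ideal g"

lemma enveloping_relations_closed:
  assumes "subspace g" "\<And>x y. x \<in> g \<Longrightarrow> y \<in> g \<Longrightarrow> bracket x y \<in> g"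
  shows "enveloping_relations g \<subseteq> carrier (free_algebra g)"
proof -
  interpret F: ring "free_algebra g" by (rule ring_free_algebra)
  have gen: "gen x \<in> carrier (free_algebra g)" if "x \<in> g" for x
    using that by (simp add: free_algebra_def gen_def)
  have const: "const c \<in> carrier (free_algebra g)" for c
    by (simp add: free_algebra_def const_def zero_word_def)
  have add: "p + q \<in> carrier (free_algebra g)" and mult: "p * q \<in> carrier (free_algebra g)"
    if "p \<in> carrier (free_algebra g)" "q \<in> carrier (free_algebra g)" for p q
    using F.a_closed[OF that] F.m_closed[OF that] by (simp_all add: free_algebra_def)
  have diff: "p - q \<in> carrier (free_algebra g)"
    if "p \<in> carrier (free_algebra g)" "q \<in> carrier (free_algebra g)" for p q
    using add[of p "- q"] that by (simp add: free_algebra_def in_keys_iff)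
  show ?thesis
    unfolding enveloping_relations_def
    using assms by (auto intro!: gen const add mult diff subspace_add subspace_scale)
qed

lemma ring_enveloping:
  assumes "subspace g" "\<And>x y. x \<in> g \<Longrightarrow> y \<in> g \<Longrightarrow> bracket x y \<in> g"
  shows "ring (enveloping g)"
  unfolding enveloping_def enveloping_ideal_def
  by (intro ideal.quotient_is_ring ring.genideal_ideal ring_free_algebra
      enveloping_relations_closed assms)

definition enveloping_proj :: "'g set \<Rightarrow> ('g word \<Rightarrow>\<^sub>0 complex) \<Rightarrow> ('g word \<Rightarrow>\<^sub>0 complex) set" where
  "enveloping_proj g p = enveloping_ideal g +>\<^bsub>free_algebra g\<^esub> p"

text \<open>For Lie subalgebras \<open>h \<subseteq> g\<close>, the algebra homomorphism \<open>enveloping h \<rightarrow> enveloping g\<close>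
  induced by the inclusion. It sends the coset of \<open>p\<close> to the coset of \<open>p\<close>, because
  \<open>enveloping_ideal h \<subseteq> enveloping_ideal g\<close>.\<close>

definition enveloping_inclusion ::
    "'g set \<Rightarrow> ('g word \<Rightarrow>\<^sub>0 complex) set \<Rightarrow> ('g word \<Rightarrow>\<^sub>0 complex) set" where
  "enveloping_inclusion g X = enveloping_ideal g <+>\<^bsub>free_algebra g\<^esub> X"

text \<open>The representation of the whole Lie algebra underlying a module over its universal
  enveloping algebra.\<close>

definition underlying_rep ::
    "(('g word \<Rightarrow>\<^sub>0 complex) set, 'm) module \<Rightarrow> ('g, 'm) lie_rep" where
  "underlying_rep M =
     \<lparr>carrier = carrier M, monoid.mult = monoid.mult M, one = one M, zero = zero M, add = add M,
      smult = (\<lambda>c v. enveloping_proj UNIV (const c) \<odot>\<^bsub>M\<^esub> v),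
      act = (\<lambda>x v. enveloping_proj UNIV (gen x) \<odot>\<^bsub>M\<^esub> v)\<rparr>"

end

locale lie_module = lie_algebra scale bracket + V?: module complex_ring V
  for scale :: "complex \<Rightarrow> 'g::ab_group_add \<Rightarrow> 'g" and bracket
    and V :: "('g, 'v) lie_rep" (structure) +
  assumes act_closed: "v \<in> carrier V \<Longrightarrow> act V x v \<in> carrier V"
    and act_add_left: "v \<in> carrier V \<Longrightarrow> act V (x + y) v = act V x v \<oplus>\<^bsub>V\<^esub> act V y v"
    and act_scale_left: "v \<in> carrier V \<Longrightarrow> act V (scale c x) v = c \<odot>\<^bsub>V\<^esub> act V x v"
    and act_add_right:
      "\<lbrakk>v \<in> carrier V; w \<in> carrier V\<rbrakk> \<Longrightarrow> act V x (v \<oplus>\<^bsub>V\<^esub> w) = act V x v \<oplus>\<^bsub>V\<^esub> act V x w"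
    and act_scale_right: "v \<in> carrier V \<Longrightarrow> act V x (c \<odot>\<^bsub>V\<^esub> v) = c \<odot>\<^bsub>V\<^esub> act V x v"
    and act_bracket:
      "v \<in> carrier V \<Longrightarrow> act V (bracket x y) v = act V x (act V y v) \<ominus>\<^bsub>V\<^esub> act V y (act V x v)"

definition lie_rep_iso :: "('g, 'v) lie_rep \<Rightarrow> ('g, 'w) lie_rep \<Rightarrow> bool" where
  "lie_rep_iso V W \<longleftrightarrow> (\<exists>\<phi>. bij_betw \<phi> (carrier V) (carrier W) \<and>
     (\<forall>v\<in>carrier V. \<forall>w\<in>carrier V. \<phi> (v \<oplus>\<^bsub>V\<^esub> w) = \<phi> v \<oplus>\<^bsub>W\<^esub> \<phi> w) \<and>
     (\<forall>c. \<forall>v\<in>carrier V. \<phi> (c \<odot>\<^bsub>V\<^esub> v) = c \<odot>\<^bsub>W\<^esub> \<phi> v) \<and>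
     (\<forall>x. \<forall>v\<in>carrier V. \<phi> (act V x v) = act W x (\<phi> v)))"


section \<open>The Lie algebra $W(2,2)$\<close>

datatype w22_index = L int | W int | C\<^sub>1 | C\<^sub>2

type_synonym w22 = "w22_index \<Rightarrow>\<^sub>0 complex"

abbreviation (input) w22_basis :: "w22_index \<Rightarrow> w22" where
  "w22_basis i \<equiv> Poly_Mapping.single i 1"

definition w22_scale :: "complex \<Rightarrow> w22 \<Rightarrow> w22" where
  "w22_scale c x = Poly_Mapping.map ((*) c) x"

definition linear_extension ::
    "(complex \<Rightarrow> 'v \<Rightarrow> 'v) \<Rightarrow> (w22_index \<Rightarrow> 'v) \<Rightarrow> w22 \<Rightarrow> 'v::comm_monoid_add" where
  "linear_extension s f x = (\<Sum>i\<in>Poly_Mapping.keys x. s (Poly_Mapping.lookup x i) (f i))"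

definition vir_term :: "(int \<Rightarrow> w22_index) \<Rightarrow> w22_index \<Rightarrow> int \<Rightarrow> int \<Rightarrow> w22" where
  "vir_term X C m n = Poly_Mapping.single (X (m + n)) (of_int (n - m)) +
     (if m + n = 0 then Poly_Mapping.single C ((of_int m ^ 3 - of_int m) / 12) else 0)"

fun w22_basis_bracket :: "w22_index \<Rightarrow> w22_index \<Rightarrow> w22" where
  "w22_basis_bracket (L m) (L n) = vir_term L C\<^sub>1 m n"
| "w22_basis_bracket (L m) (W n) = vir_term W C\<^sub>2 m n"
| "w22_basis_bracket (W m) (L n) = - vir_term W C\<^sub>2 n m"
| "w22_basis_bracket _ _ = 0"

definition w22_bracket :: "w22 \<Rightarrow> w22 \<Rightarrow> w22" where
  "w22_bracket x y =
     linear_extension w22_scale (\<lambda>i. linear_extension w22_scale (w22_basis_bracket i) y) x"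

lemma lookup_w22_scale [simp]:
  "Poly_Mapping.lookup (w22_scale c x) i = c * Poly_Mapping.lookup x i"
  by (simp add: w22_scale_def Poly_Mapping.map.rep_eq when_def)

lemma vector_space_w22: "vector_space w22_scale"
  by (unfold_locales;
    auto intro!: poly_mapping_eqI simp: lookup_add algebra_simps)

lemma w22_induct [case_names zero basis add]:
  assumes "P 0" "\<And>c i. P (w22_scale c (w22_basis i))" "\<And>x y. P x \<Longrightarrow> P y \<Longrightarrow> P (x + y)"
  shows "P x"
proof (induction x rule: update_induct)
  case const
  then show ?case by (simp add: assms(1))
next
  case (update f a b)
  have "Poly_Mapping.update a b f = f + w22_scale b (w22_basis a)"
    using update by (intro poly_mapping_eqI)
      (auto simp: lookup_add lookup_update lookup_single when_def in_keys_iff)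
  then show ?case using assms update by simp
qed

lemma linear_extension_superset:
  assumes "vector_space s" "finite A" "Poly_Mapping.keys x \<subseteq> A"
  shows "linear_extension s f x = (\<Sum>i\<in>A. s (Poly_Mapping.lookup x i) (f i))"
proof -
  interpret vector_space s by fact
  show ?thesis unfolding linear_extension_def
    using assms by (intro sum.mono_neutral_left) (auto simp: in_keys_iff)
qed

lemma linear_extension_add:
  assumes "vector_space s"
  shows "linear_extension s f (x + y) = linear_extension s f x + linear_extension s f y"
proof -
  interpret vector_space s by fact
  let ?A = "Poly_Mapping.keys x \<union> Poly_Mapping.keys y"
  have "Poly_Mapping.keys (x + y) \<subseteq> ?A" by (rule keys_add)
  then show ?thesis
    by (simp add: linear_extension_superset[OF assms, of ?A] lookup_add scale_left_distrib
        sum.distrib)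
qed

lemma linear_extension_scale:
  assumes "vector_space s"
  shows "linear_extension s f (w22_scale c x) = s c (linear_extension s f x)"
proof -
  interpret vector_space s by fact
  have "Poly_Mapping.keys (w22_scale c x) \<subseteq> Poly_Mapping.keys x"
    by (auto simp: in_keys_iff)
  then show ?thesis
    by (simp add: linear_extension_superset[OF assms, of "Poly_Mapping.keys x"] scale_sum_right)
qed

lemma linear_extension_basis:
  assumes "vector_space s"
  shows "linear_extension s f (w22_basis i) = f i"
proof -
  interpret vector_space s by fact
  show ?thesis by (simp add: linear_extension_def)
qed

lemma linear_extension_fun_add:
  assumes "vector_space s"
  shows "linear_extension s (\<lambda>i. f i + g i) x = linear_extension s f x + linear_extension s g x"
proof -
  interpret vector_space s by fact
  show ?thesis by (simp add: linear_extension_def scale_right_distrib sum.distrib)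
qed

lemma linear_extension_fun_scale:
  assumes "vector_space s"
  shows "linear_extension s (\<lambda>i. s c (f i)) x = s c (linear_extension s f x)"
proof -
  interpret vector_space s by fact
  show ?thesis by (simp add: linear_extension_def scale_sum_right mult.commute)
qed

lemma w22_bracket_basis [simp]:
  "w22_bracket (w22_basis i) (w22_basis j) = w22_basis_bracket i j"
  by (simp add: w22_bracket_def linear_extension_basis vector_space_w22)

lemma w22_bracket_linear:
  "w22_bracket (x + y) z = w22_bracket x z + w22_bracket y z"
  "w22_bracket x (y + z) = w22_bracket x y + w22_bracket x z"
  "w22_bracket (w22_scale c x) y = w22_scale c (w22_bracket x y)"
  "w22_bracket x (w22_scale c y) = w22_scale c (w22_bracket x y)"
  by (simp_all add: w22_bracket_def linear_extension_add linear_extension_scale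
      linear_extension_fun_add linear_extension_fun_scale[OF vector_space_w22] vector_space_w22)

lemma w22_bracket_zero [simp]: "w22_bracket 0 x = 0" "w22_bracket x 0 = 0"
  using w22_bracket_linear(1)[of 0 0 x] w22_bracket_linear(2)[of x 0 0] by simp_all

lemma w22_single: "Poly_Mapping.single i c = w22_scale c (w22_basis i)"
  by (intro poly_mapping_eqI) (simp add: lookup_single when_def)

lemma vir_term_anticommute: "vir_term X C m n = - vir_term X C n m"
proof (cases "m + n = 0")
  case True
  then have n: "n = - m" by simp
  have "Poly_Mapping.single i (- c) = - Poly_Mapping.single i c" for i :: w22_index and c :: complex
    by (rule single_uminus)
  moreover have "(of_int (- m) ^ 3 - of_int (- m)) / 12 =
      (- ((of_int m ^ 3 - of_int m) / 12) :: complex)"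
    by (simp add: field_simps)
  moreover have "(of_int (- m - m) :: complex) = - of_int (m - - m)"
    by simp
  ultimately show ?thesis
    by (simp only: n vir_term_def) (simp add: single_uminus)
next
  case False
  have "(of_int (n - m) :: complex) = - of_int (m - n)"
    by simp
  with False show ?thesis
    by (simp add: vir_term_def add.commute single_uminus del: of_int_diff)
qed

lemma w22_basis_bracket_WL: "w22_basis_bracket (W m) (L n) = vir_term W C\<^sub>2 m n"
  using vir_term_anticommute[of W "C\<^sub>2" m n] by simp

lemma w22_basis_bracket_anticommute: "w22_basis_bracket i j = - w22_basis_bracket j i"
  by (cases i; cases j) (auto simp: vir_term_anticommute[symmetric])

lemma w22_scale_simps:
  "w22_scale c (x + y) = w22_scale c x + w22_scale c y"
  "w22_scale c (w22_scale d x) = w22_scale (c * d) x"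
  "w22_scale c (- x) = - w22_scale c x"
  "w22_scale c 0 = 0"
  by (auto intro!: poly_mapping_eqI simp: lookup_add algebra_simps)

lemma w22_bracket_anticommute: "w22_bracket x y = - w22_bracket y x"
proof (induction x rule: w22_induct)
  case (basis c i)
  show ?case
  proof (induction y rule: w22_induct)
    case (basis d j)
    then show ?case
      using w22_basis_bracket_anticommute[of i j]
      by (simp add: w22_bracket_linear w22_scale_simps mult.commute)
  qed (simp_all add: w22_bracket_linear w22_scale_simps)
qed (simp_all add: w22_bracket_linear)

lemma w22_bracket_self: "w22_bracket x x = 0"
proof (rule poly_mapping_eqI)
  fix k
  have "Poly_Mapping.lookup (w22_bracket x x) k = - Poly_Mapping.lookup (w22_bracket x x) k"
    using arg_cong[OF w22_bracket_anticommute[of x x], of "\<lambda>p. Poly_Mapping.lookup p k"] by simp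
  then show "Poly_Mapping.lookup (w22_bracket x x) k = Poly_Mapping.lookup 0 k"
    by simp
qed

lemma w22_basis_bracket_central [simp]:
  "w22_basis_bracket i C\<^sub>1 = 0" "w22_basis_bracket i C\<^sub>2 = 0"
  by (cases i; simp)+

lemma w22_bracket_vir:
  assumes "D = C\<^sub>1 \<or> D = C\<^sub>2"
  shows "w22_bracket (w22_basis i) (vir_term X D m n) =
     w22_scale (of_int (n - m)) (w22_basis_bracket i (X (m + n)))"
  using assms
  by (auto simp: vir_term_def w22_bracket_linear w22_scale_simps w22_single[of _ "of_int _"]
      w22_single[of _ "_ / _"] simp del: of_int_diff)

lemma vir_term_jacobi:
  "w22_scale (of_int (n - m)) (vir_term X D k (m + n)) +
   w22_scale (of_int (k - n)) (vir_term X D m (n + k)) +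
   w22_scale (of_int (m - k)) (vir_term X D n (k + m)) = 0"
proof -
  have 1: "(of_int (n - m) * of_int (m + n - k) + of_int (k - n) * of_int (n + k - m) +
    of_int (m - k) * of_int (k + m - n) :: complex) = 0"
    by (simp add: algebra_simps)
  have 2: "(of_int (n - m) * ((of_int k ^ 3 - of_int k) / 12) +
    of_int (k - n) * ((of_int m ^ 3 - of_int m) / 12) +
    of_int (m - k) * ((of_int n ^ 3 - of_int n) / 12) :: complex) = 0" if "k + (m + n) = 0"
  proof -
    have k: "k = - m - n" using that by simp
    show ?thesis unfolding k by (simp add: field_simps power3_eq_cube)
  qed
  have eq: "m + (n + k) = k + (m + n)" "n + (k + m) = k + (m + n)" by simp_all
  show ?thesis
  proof (rule poly_mapping_eqI)
    fix j
    show "Poly_Mapping.lookup (w22_scale (of_int (n - m)) (vir_term X D k (m + n)) +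
        w22_scale (of_int (k - n)) (vir_term X D m (n + k)) +
        w22_scale (of_int (m - k)) (vir_term X D n (k + m))) j = Poly_Mapping.lookup 0 j"
    proof (cases "k + (m + n) = 0")
      case True
      show ?thesis
        unfolding vir_term_def eq using 1 2[OF True] True
        by (cases "X 0 = j"; cases "D = j")
          (simp_all add: lookup_add lookup_single distrib_left add_ac)
    next
      case False
      then show ?thesis
        unfolding vir_term_def eq using 1
        by (cases "X (k + (m + n)) = j") (simp_all add: lookup_add lookup_single)
    qed
  qed
qed

lemma w22_jacobi_basis:
  "w22_bracket (w22_basis i) (w22_basis_bracket j l) +
   w22_bracket (w22_basis j) (w22_basis_bracket l i) +
   w22_bracket (w22_basis l) (w22_basis_bracket i j) = 0"
  using vir_term_jacobi
  by (cases i; cases j; cases l)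
    (simp_all add: w22_bracket_vir w22_basis_bracket_WL w22_scale_simps
      del: w22_basis_bracket.simps(3) of_int_diff)

lemma w22_jacobi:
  "w22_bracket x (w22_bracket y z) + w22_bracket y (w22_bracket z x) +
   w22_bracket z (w22_bracket x y) = 0"
proof -
  define J where "J = (\<lambda>x y z. w22_bracket x (w22_bracket y z) + w22_bracket y (w22_bracket z x) +
    w22_bracket z (w22_bracket x y))"
  have add: "J (x + x') y z = J x y z + J x' y z" "J x (y + y') z = J x y z + J x y' z"
    "J x y (z + z') = J x y z + J x y z'" for x x' y y' z z'
    by (simp_all add: J_def w22_bracket_linear add_ac)
  have scale: "J (w22_scale c x) y z = w22_scale c (J x y z)"
    "J x (w22_scale c y) z = w22_scale c (J x y z)"
    "J x y (w22_scale c z) = w22_scale c (J x y z)" for c x y z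
    by (simp_all add: J_def w22_bracket_linear w22_scale_simps)
  have zero: "J 0 y z = 0" "J x 0 z = 0" "J x y 0 = 0" for x y z
    by (simp_all add: J_def)
  have basis: "J (w22_basis i) (w22_basis j) (w22_basis l) = 0" for i j l
    using w22_jacobi_basis[of i j l] by (simp add: J_def)
  have 1: "J (w22_basis i) (w22_basis j) z = 0" for i j z
    by (induction z rule: w22_induct) (simp_all add: add scale zero basis w22_scale_simps)
  have 2: "J (w22_basis i) y z = 0" for i y z
    by (induction y rule: w22_induct) (simp_all add: add scale zero 1 w22_scale_simps)
  have "J x y z = 0"
    by (induction x rule: w22_induct) (simp_all add: add scale zero 2 w22_scale_simps)
  then show ?thesis by (simp add: J_def)
qed

global_interpretation W22: lie_algebra w22_scale w22_bracket
  by (intro lie_algebra.intro lie_algebra_axioms.intro vector_space_w22 w22_bracket_linear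
      w22_bracket_self w22_jacobi)


section \<open>The modules $\Omega(\lambda,\alpha)$\<close>

definition omega_basis_act :: "complex \<Rightarrow> complex \<Rightarrow> w22_index \<Rightarrow> complex poly \<Rightarrow> complex poly" where
  "omega_basis_act lam \<alpha> i f =
     (case i of
        L m \<Rightarrow> Polynomial.smult (lam powi m) ([:- (of_int m * \<alpha>), 1:] * pcompose f [:- of_int m, 1:])
      | _ \<Rightarrow> 0)"

definition Omega :: "complex \<Rightarrow> complex \<Rightarrow> (w22, complex poly) lie_rep" where
  "Omega lam \<alpha> =
     \<lparr>carrier = UNIV, monoid.mult = (*), one = 1, zero = 0, add = (+), smult = Polynomial.smult,
      act = (\<lambda>x f. linear_extension Polynomial.smult (\<lambda>i. omega_basis_act lam \<alpha> i f) x)\<rparr>"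

lemma vector_space_poly: "vector_space (Polynomial.smult :: complex \<Rightarrow> _)"
  by unfold_locales (simp_all add: smult_add_right smult_add_left)

lemma omega_basis_act_linear:
  "omega_basis_act lam \<alpha> i (f + g) = omega_basis_act lam \<alpha> i f + omega_basis_act lam \<alpha> i g"
  "omega_basis_act lam \<alpha> i (Polynomial.smult c f) =
     Polynomial.smult c (omega_basis_act lam \<alpha> i f)"
  by (cases i; simp add: omega_basis_act_def pcompose_add pcompose_smult ring_distribs
      smult_add_right mult.commute)+

lemma omega_act_linear:
  "act (Omega lam \<alpha>) (x + y) f = act (Omega lam \<alpha>) x f + act (Omega lam \<alpha>) y f"
  "act (Omega lam \<alpha>) (w22_scale c x) f = Polynomial.smult c (act (Omega lam \<alpha>) x f)"
  "act (Omega lam \<alpha>) x (f + g) = act (Omega lam \<alpha>) x f + act (Omega lam \<alpha>) x g"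
  "act (Omega lam \<alpha>) x (Polynomial.smult c f) = Polynomial.smult c (act (Omega lam \<alpha>) x f)"
  by (simp_all add: Omega_def linear_extension_add linear_extension_scale omega_basis_act_linear
      linear_extension_fun_add linear_extension_fun_scale[OF vector_space_poly] vector_space_poly)

lemma omega_act_basis: "act (Omega lam \<alpha>) (w22_basis i) f = omega_basis_act lam \<alpha> i f"
  by (simp add: Omega_def linear_extension_basis vector_space_poly)

lemma omega_act_zero: "act (Omega lam \<alpha>) 0 f = 0" "act (Omega lam \<alpha>) x 0 = 0"
  using omega_act_linear(1)[of lam \<alpha> 0 0 f] omega_act_linear(3)[of lam \<alpha> x 0 0] by simp_all

lemma omega_act_vir:
  "act (Omega lam \<alpha>) (vir_term L C\<^sub>1 m n) f =
     Polynomial.smult (of_int (n - m)) (omega_basis_act lam \<alpha> (L (m + n)) f)"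
  "act (Omega lam \<alpha>) (vir_term W C\<^sub>2 m n) f = 0"
  by (auto simp: vir_term_def omega_act_linear omega_act_basis w22_single[of _ "of_int _"]
      w22_single[of _ "_ / _"] omega_act_zero omega_basis_act_def simp del: of_int_diff)

lemma omega_basis_act_commutator:
  assumes "lam \<noteq> 0"
  shows "Polynomial.smult (of_int (n - m)) (omega_basis_act lam \<alpha> (L (m + n)) f) =
    omega_basis_act lam \<alpha> (L m) (omega_basis_act lam \<alpha> (L n) f) -
    omega_basis_act lam \<alpha> (L n) (omega_basis_act lam \<alpha> (L m) f)"
proof (rule poly_eq_poly_eq_iff[THEN iffD1], rule ext)
  fix t :: complex
  have "lam powi (m + n) = lam powi m * lam powi n"
    using assms by (simp add: power_int_add)
  moreover have "t - (of_int m + of_int n) = t - of_int n - of_int m" by simp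
  ultimately show "poly (Polynomial.smult (of_int (n - m)) (omega_basis_act lam \<alpha> (L (m + n)) f)) t =
      poly (omega_basis_act lam \<alpha> (L m) (omega_basis_act lam \<alpha> (L n) f) -
        omega_basis_act lam \<alpha> (L n) (omega_basis_act lam \<alpha> (L m) f)) t"
    by (simp add: omega_basis_act_def poly_pcompose algebra_simps)
qed

lemma omega_act_commutator_basis:
  assumes "lam \<noteq> 0"
  shows "act (Omega lam \<alpha>) (w22_basis_bracket i j) f =
    omega_basis_act lam \<alpha> i (omega_basis_act lam \<alpha> j f) -
    omega_basis_act lam \<alpha> j (omega_basis_act lam \<alpha> i f)"
proof -
  have "omega_basis_act lam \<alpha> k 0 = 0" for k
    by (cases k) (simp_all add: omega_basis_act_def)
  then show ?thesis
    using omega_basis_act_commutator[OF assms]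
    by (cases i; cases j)
      (simp_all add: omega_act_vir w22_basis_bracket_WL omega_act_zero omega_basis_act_def
        del: w22_basis_bracket.simps(3) of_int_diff)
qed

lemma omega_act_commutator:
  assumes "lam \<noteq> 0"
  shows "act (Omega lam \<alpha>) (w22_bracket x y) f =
    act (Omega lam \<alpha>) x (act (Omega lam \<alpha>) y f) - act (Omega lam \<alpha>) y (act (Omega lam \<alpha>) x f)"
proof (induction x rule: w22_induct)
  case (basis c i)
  show ?case
  proof (induction y rule: w22_induct)
    case (basis d j)
    show ?case
      by (simp add: w22_bracket_linear omega_act_linear omega_act_basis
          omega_act_commutator_basis[OF assms] smult_diff_right mult.commute)
  next
    case (add x y)
    then show ?case by (simp add: w22_bracket_linear omega_act_linear smult_add_right)
  qed (simp add: omega_act_zero)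
next
  case (add x y)
  then show ?case by (simp add: w22_bracket_linear omega_act_linear smult_add_right)
qed (simp add: omega_act_zero)

lemma lie_module_Omega:
  assumes "lam \<noteq> 0"
  shows "lie_module w22_scale w22_bracket (Omega lam \<alpha>)"
proof -
  have ring: "cring complex_ring"
    by (rule cringI)
      (auto intro!: abelian_groupI comm_monoidI
        simp: complex_ring_def algebra_simps add_eq_0_iff)
  have grp: "abelian_group (Omega lam \<alpha>)"
    by (rule abelian_groupI) (auto simp: Omega_def algebra_simps add_eq_0_iff)
  interpret V: module complex_ring "Omega lam \<alpha>"
    by (rule moduleI[OF ring grp])
      (simp_all add: Omega_def complex_ring_def smult_add_left smult_add_right)
  have minus: "f \<ominus>\<^bsub>Omega lam \<alpha>\<^esub> g = f - g" for f g
  proof -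
    have "\<ominus>\<^bsub>Omega lam \<alpha>\<^esub> g = - g"
      by (rule V.minus_equality) (simp_all add: Omega_def)
    then show ?thesis by (simp add: a_minus_def) (simp add: Omega_def)
  qed
  have simps: "carrier (Omega lam \<alpha>) = UNIV" "f \<oplus>\<^bsub>Omega lam \<alpha>\<^esub> g = f + g"
    "c \<odot>\<^bsub>Omega lam \<alpha>\<^esub> f = Polynomial.smult c f" for c f g
    by (simp_all add: Omega_def)
  show ?thesis
    by (intro lie_module.intro lie_module_axioms.intro V.module_axioms W22.lie_algebra_axioms)
      (simp_all add: simps minus omega_act_linear omega_act_commutator[OF assms])
qed

end

theory Submission
  imports Defs "HOL-Computational_Algebra.Fundamental_Theorem_Algebra"
begin

text \<open>
  A basis \<open>b\<close> over \<open>U(\<complex>L\<^sub>0) = \<complex>[t]\<close> turns the module into \<open>\<complex>[t]\<close> with \<open>L\<^sub>0\<close> acting as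
  multiplication by \<open>t\<close>. The brackets with \<open>L\<^sub>0\<close> then force \<open>L\<^sub>m f(t) = g\<^sub>m(t) f(t - m)\<close>,
  \<open>W\<^sub>m f(t) = h\<^sub>m(t) f(t - m)\<close>, and \<open>C\<^sub>1\<close>, \<open>C\<^sub>2\<close> to act by multiplication.
  Comparing degrees in the brackets of \<open>L\<^sub>1\<close>, \<open>L\<^sub>-\<^sub>1\<close> with each other and with \<open>L\<^sub>2\<close>, \<open>L\<^sub>-\<^sub>2\<close>
  shows that these four \<open>g\<^sub>m\<close> are linear, and comparing coefficients determines them and \<open>C\<^sub>1\<close>;
  the remaining \<open>g\<^sub>m\<close> follow by bracketing with \<open>L\<^sub>1\<close> and \<open>L\<^sub>-\<^sub>1\<close>.
  From \<open>[L\<^sub>1, W\<^sub>0] = - W\<^sub>1\<close> and \<open>[W\<^sub>1, W\<^sub>0] = 0\<close> one gets \<open>g\<^sub>1(t) (h\<^sub>0(t) - h\<^sub>0(t - 1))\<^sup>2 = 0\<close>,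
  so \<open>h\<^sub>0\<close> is constant, and then all \<open>h\<^sub>m\<close> and \<open>C\<^sub>2\<close> vanish.

  A submodule of \<open>\<Omega>(\<lambda>,\<alpha>)\<close> is an ideal \<open>(f)\<close> of \<open>\<complex>[t]\<close>. If \<open>f \<noteq> 0\<close> had a root \<open>r\<close>, then
  \<open>(r - m\<alpha>) f(r - m) = 0\<close> for all integers \<open>m\<close>, which is impossible for \<open>\<alpha> \<noteq> 0\<close>; for \<open>\<alpha> = 0\<close>
  the ideal \<open>(t)\<close> is a submodule.
\<close>

section \<open>Shifts of polynomials\<close>

text \<open>The bound \<open>Suc n\<close> may exceed the degree, so that the induction hypothesis
  applies to the tail \<open>q\<close> whatever its degree.\<close>

lemma degree_shift_diff:
  fixes p :: "'a::idom poly"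
  assumes "degree p \<le> Suc n"
  shows "degree (pcompose p [:a, 1:] - p) \<le> n \<and>
    coeff (pcompose p [:a, 1:] - p) n = a * of_nat (Suc n) * coeff p (Suc n)"
  using assms
proof (induction p arbitrary: n)
  case 0
  then show ?case by simp
next
  case (pCons c q)
  let ?d = "pcompose q [:a, 1:] - q"
  \<comment> \<open>With p = c + t q and d = q(t + a) - q(t), the difference is (t + a) d + a q; its
    top coefficient comes from t d and a q.\<close>
  have eq: "pcompose (pCons c q) [:a, 1:] - pCons c q = pCons 0 ?d + Polynomial.smult a ?d + Polynomial.smult a q"
    by (rule poly_eqI) (simp add: pcompose_pCons coeff_pCons algebra_simps split: nat.split)
  have dq: "degree q \<le> n"
    using pCons.prems by (cases "q = 0") simp_all
  show ?case
  proof (cases n)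
    case 0
    then obtain b where "q = [:b:]"
      using dq degree_eq_zeroE by (metis le_zero_eq)
    then show ?thesis by (simp add: 0 pcompose_pCons)
  next
    case (Suc k)
    have d: "degree ?d \<le> k" "coeff ?d k = a * of_nat (Suc k) * coeff q (Suc k)"
      using pCons.IH[of k] dq Suc by simp_all
    have "degree (pCons 0 ?d) \<le> n" "degree (Polynomial.smult a ?d) \<le> n" "degree (Polynomial.smult a q) \<le> n"
      using d(1) dq Suc degree_smult_le[of a ?d] degree_smult_le[of a q] degree_pCons_le[of 0 ?d]
      by linarith+
    moreover have "coeff ?d n = 0"
      using d(1) Suc by (intro coeff_eq_0) simp
    ultimately show ?thesis
      unfolding eq using d(2)
      by (simp add: degree_add_le Suc algebra_simps)
  qed
qed

lemma coeff_mult_degree_le: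
  fixes p q :: "'a::idom poly"
  assumes "degree p \<le> m" "degree q \<le> n"
  shows "coeff (p * q) (m + n) = coeff p m * coeff q n"
proof (cases "degree p = m \<and> degree q = n")
  case True
  then show ?thesis using coeff_mult_degree_sum[of p q] by simp
next
  case False
  then have "degree (p * q) < m + n"
    using assms degree_mult_le[of p q] by linarith
  then show ?thesis
    using False assms by (auto simp: coeff_eq_0)
qed

text \<open>The products p q cancel in \<open>D\<close>, leaving p dq - q dp. At the exponent deg p
  + deg q - 1 its coefficient is (a deg q - b deg p) times both leading coefficients.\<close>

lemma degree_shift_commutator:
  fixes p q :: "'a::idom poly" and a b
  defines "D \<equiv> p * pcompose q [:a, 1:] - q * pcompose p [:b, 1:]"
  assumes "p \<noteq> 0" "q \<noteq> 0" "a * of_nat (degree q) \<noteq> b * of_nat (degree p)"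
  shows "D \<noteq> 0" "Suc (degree D) = degree p + degree q"
proof -
  define dp dq where "dp = pcompose p [:b, 1:] - p" and "dq = pcompose q [:a, 1:] - q"
  \<comment> \<open>Multiplying by t (\<open>pCons 0\<close>) avoids the exponent
    \<open>degree r - 1\<close> and lets constants, whose difference is 0, share the
    formula.\<close>
  have lead: "degree (pCons 0 (pcompose r [:c, 1:] - r)) \<le> degree r \<and>
      coeff (pCons 0 (pcompose r [:c, 1:] - r)) (degree r) = c * of_nat (degree r) * lead_coeff r"
    for r :: "'a poly" and c
  proof (cases "degree r")
    case 0
    then obtain k where "r = [:k:]" using degree_eq_zeroE by blast
    then show ?thesis by (simp add: pcompose_pCons)
  next
    case (Suc n)
    with degree_shift_diff[of r n c] show ?thesis
      using degree_pCons_le[of 0 "pcompose r [:c, 1:] - r"] by simp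
  qed
  have eq: "pCons 0 D = p * pCons 0 dq - pCons 0 dp * q"
    by (simp add: D_def dp_def dq_def algebra_simps)
  have "coeff (pCons 0 D) (degree p + degree q) =
      (a * of_nat (degree q) - b * of_nat (degree p)) * lead_coeff p * lead_coeff q"
    unfolding eq coeff_diff dp_def dq_def
    using lead[of p b] lead[of q a]
    by (simp only: coeff_mult_degree_le order_refl) (simp add: algebra_simps)
  then have nz: "coeff (pCons 0 D) (degree p + degree q) \<noteq> 0"
    using assms by simp
  then show "D \<noteq> 0" by auto
  moreover have "degree (pCons 0 D) \<le> degree p + degree q"
    unfolding eq dp_def dq_def
    by (intro degree_diff_le order.trans[OF degree_mult_le] add_mono conjunct1[OF lead] order_refl)
  moreover have "degree p + degree q \<le> degree (pCons 0 D)"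
    using nz by (rule le_degree)
  ultimately show "Suc (degree D) = degree p + degree q"
    by simp
qed

lemma shift_periodic_imp_const:
  fixes p :: "'a::{idom,ring_char_0} poly"
  assumes "pcompose p [:a, 1:] = p" "a \<noteq> 0"
  shows "degree p = 0"
proof (rule ccontr)
  assume "degree p \<noteq> 0"
  then obtain n where n: "degree p = Suc n" by (cases "degree p") auto
  then have "a * of_nat (Suc n) * lead_coeff p = 0"
    using degree_shift_diff[of p n a] assms(1) by simp
  moreover have "lead_coeff p \<noteq> 0" using n by (metis degree_0 leading_coeff_0_iff nat.distinct(1))
  ultimately show False using assms(2) by (simp del: of_nat_Suc)
qed

lemma degree_one_smultE:
  fixes p :: "'a::field poly"
  assumes "degree p = 1"
  obtains a c where "p = Polynomial.smult c [:- a, 1:]" "c \<noteq> 0"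
proof -
  obtain u v where p: "p = [:u, v:]"
    using assms by (cases p) (auto elim!: degree_eq_zeroE split: if_splits)
  with assms have "v \<noteq> 0" by auto
  with p that[of v "- u / v"] show thesis by simp
qed

section \<open>Solving the Virasoro relations on polynomials\<close>

text \<open>\<open>comm\<close> is the bracket of L_m and L_n applied to 1, with \<open>c\<close>
  the value of C_1 at 1. Indices 2 and -2 are treated by hand because the factor n - m vanishes in
  the bracket of L_1 or L_{-1} with itself; later indices are reached by induction.\<close>

lemma virasoro_polynomials:
  fixes g :: "int \<Rightarrow> complex poly" and c :: "complex poly"
  assumes comm: "\<And>m n. g m * pcompose (g n) [:- of_int m, 1:] - g n * pcompose (g m) [:- of_int n, 1:] =
      Polynomial.smult (of_int (n - m)) (g (m + n)) +
      (if m + n = 0 then Polynomial.smult ((of_int m ^ 3 - of_int m) / 12) c else 0)"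
    and g0: "g 0 = [:0, 1:]"
  obtains lam \<alpha> where "lam \<noteq> 0" "c = 0"
    "\<And>m. g m = Polynomial.smult (lam powi m) [:- (of_int m * \<alpha>), 1:]"
proof -
  have c1: "g 1 * pcompose (g (-1)) [:-1, 1:] - g (-1) * pcompose (g 1) [:1, 1:] = [:0, -2:]"
    using comm[of 1 "-1"] by (simp add: g0)
  have c2: "g 2 * pcompose (g (-1)) [:-2, 1:] - g (-1) * pcompose (g 2) [:1, 1:] = Polynomial.smult (-3) (g 1)"
    using comm[of 2 "-1"] by simp
  have c3: "g (-2) * pcompose (g 1) [:2, 1:] - g 1 * pcompose (g (-2)) [:-1, 1:] = Polynomial.smult 3 (g (-1))"
    using comm[of "-2" 1] by simp
  have nz1: "g 1 \<noteq> 0" "g (-1) \<noteq> 0" using c1 by auto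
  have nz2: "g 2 \<noteq> 0" "g (-2) \<noteq> 0" using c2 c3 nz1 by auto
  \<comment> \<open>Two constants would commute, against \<open>c1\<close>. Otherwise - deg g_{-1}
    differs from deg g_1, and \<open>degree_shift_commutator\<close> equates deg g_1 + deg g_{-1} -
    1 with the degree of -2 t.\<close>
  have d1: "degree (g 1) + degree (g (-1)) = 2"
  proof (cases "degree (g 1) = 0 \<and> degree (g (-1)) = 0")
    case True
    then obtain a b where "g 1 = [:a:]" "g (-1) = [:b:]"
      using degree_eq_zeroE by metis
    then show ?thesis using c1 by simp
  next
    case False
    have "(-1) * of_nat (degree (g (-1))) \<noteq> (1::complex) * of_nat (degree (g 1))"
    proof
      assume "(-1) * of_nat (degree (g (-1))) = (1::complex) * of_nat (degree (g 1))"
      then have "(of_nat (degree (g 1) + degree (g (-1))) :: complex) = 0"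
        by (simp add: minus_equation_iff add_eq_0_iff)
      then show False using False unfolding of_nat_eq_0_iff by simp
    qed
    from degree_shift_commutator(2)[OF nz1 this] show ?thesis by (simp add: c1)
  qed
  have d2: "Suc (degree (g 1)) = degree (g 2) + degree (g (-1))"
    if "degree (g 2) \<noteq> 0 \<or> degree (g (-1)) \<noteq> 0"
  proof -
    have "(-2) * of_nat (degree (g (-1))) \<noteq> (1::complex) * of_nat (degree (g 2))"
    proof
      assume "(-2) * of_nat (degree (g (-1))) = (1::complex) * of_nat (degree (g 2))"
      then have "(of_nat (degree (g 2) + 2 * degree (g (-1))) :: complex) = 0"
        by (simp flip: eq_neg_iff_add_eq_0)
      then show False using that unfolding of_nat_eq_0_iff by simp
    qed
    from degree_shift_commutator(2)[OF nz2(1) nz1(2) this] show ?thesis by (simp add: c2)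
  qed
  have d3: "Suc (degree (g (-1))) = degree (g (-2)) + degree (g 1)"
    if "degree (g (-2)) \<noteq> 0 \<or> degree (g 1) \<noteq> 0"
  proof -
    have "2 * of_nat (degree (g 1)) \<noteq> (-1::complex) * of_nat (degree (g (-2)))"
    proof
      assume "2 * of_nat (degree (g 1)) = (-1::complex) * of_nat (degree (g (-2)))"
      then have "(of_nat (degree (g (-2)) + 2 * degree (g 1)) :: complex) = 0" by simp
      then show False using that unfolding of_nat_eq_0_iff by simp
    qed
    from degree_shift_commutator(2)[OF nz2(2) nz1(1) this] show ?thesis by (simp add: c3)
  qed
  \<comment> \<open>Of the pairs (2,0), (1,1), (0,2), \<open>d3\<close> excludes the first and
    \<open>d2\<close> the last, since they would force a negative degree of g_{-2} or g_2.\<close>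
  have deg1: "degree (g 1) = 1" "degree (g (-1)) = 1"
    using d1 d2 d3 by linarith+
  then have deg2: "degree (g 2) = 1" "degree (g (-2)) = 1"
    using d2 d3 by simp_all
  obtain lam \<alpha> where g1: "g 1 = Polynomial.smult lam [:- \<alpha>, 1:]" and lam: "lam \<noteq> 0"
    using degree_one_smultE[OF deg1(1)] by metis
  obtain \<mu> \<beta> where gm1: "g (-1) = Polynomial.smult \<mu> [:- \<beta>, 1:]" and \<mu>: "\<mu> \<noteq> 0"
    using degree_one_smultE[OF deg1(2)] by metis
  obtain \<nu> \<gamma> where g2: "g 2 = Polynomial.smult \<nu> [:- \<gamma>, 1:]" and \<nu>: "\<nu> \<noteq> 0"
    using degree_one_smultE[OF deg2(1)] by metis
  obtain \<pi> \<delta> where gm2: "g (-2) = Polynomial.smult \<pi> [:- \<delta>, 1:]" and \<pi>: "\<pi> \<noteq> 0"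
    using degree_one_smultE[OF deg2(2)] by metis
  \<comment> \<open>The quadratic terms cancel, so each of \<open>c1\<close>, \<open>c2\<close>,
    \<open>c3\<close> is an identity of linear polynomials; its two coefficients fix one scale
    factor and one root in terms of \<open>lam\<close> and \<alpha>.\<close>
  have "\<alpha> * (\<mu> * lam) + \<beta> * (\<mu> * lam) = 0" "\<mu> * lam = 1"
    using c1 unfolding g1 gm1 by (auto simp: pcompose_pCons algebra_simps)
  then have \<beta>: "\<beta> = - \<alpha>" and \<mu>': "\<mu> = inverse lam"
    using inverse_unique[of lam \<mu>] by (simp_all add: eq_neg_iff_add_eq_0 add.commute mult.commute)
  have "\<nu> * \<mu> = lam" "\<nu> * \<mu> * (2 * \<gamma> - \<alpha>) = 3 * lam * \<alpha>"
    using c2 unfolding g1 gm1 g2 \<beta> by (auto simp: pcompose_pCons algebra_simps)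
  then have \<nu>': "\<nu> = lam\<^sup>2" and \<gamma>: "\<gamma> = 2 * \<alpha>"
    using lam unfolding \<mu>' by (simp_all add: field_simps power2_eq_square)
  have "\<pi> * lam = \<mu>" "\<pi> * lam * (2 * \<delta> + \<alpha>) = - 3 * \<mu> * \<alpha>"
    using c3 unfolding g1 gm1 gm2 \<beta> by (auto simp: pcompose_pCons algebra_simps)
  note \<pi>_eqs = this
  then have \<pi>': "\<pi> = (inverse lam)\<^sup>2"
    using lam unfolding \<mu>' by (simp add: field_simps power2_eq_square)
  have "\<mu> * (2 * \<delta>) = \<mu> * (2 * (- 2 * \<alpha>))"
    using \<pi>_eqs(2) unfolding \<pi>_eqs(1) by (simp add: algebra_simps flip: eq_diff_eq)
  then have \<delta>: "\<delta> = - 2 * \<alpha>"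
    using \<mu> by (metis mult_left_cancel zero_neq_numeral)
  \<comment> \<open>At m = 2 the central coefficient (m^3 - m)/12 is 1/2, whereas it is 0 at m = 1;
    all other terms cancel.\<close>
  have "Polynomial.smult (1 / 2) c = 0"
    using comm[of 2 "-2"] lam unfolding g2 gm2 \<nu>' \<pi>' \<gamma> \<delta> g0
    by (simp add: g0 pcompose_pCons algebra_simps flip: power_mult_distrib)
  then have "c = 0" by simp
  \<comment> \<open>[L_1, L_n] = (n - 1) L_{n+1} gives the step for n at least 2; the step from n =
    1 uses g_2 as found above.\<close>
  have pos: "g (int n) = Polynomial.smult (lam ^ n) [:- (of_nat n * \<alpha>), 1:]" for n
  proof (induction n)
    case (Suc n)
    consider "n = 0" | "n = 1" | "n \<ge> 2" by linarith
    then show ?case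
    proof cases
      case 3
      then have ne: "(of_nat n - 1 :: complex) \<noteq> 0"
        by (metis of_nat_1 of_nat_eq_iff eq_iff_diff_eq_0 Suc_1 not_less_eq_eq order_refl)
      have "Polynomial.smult (of_nat n - 1) (g (int (Suc n))) =
          Polynomial.smult (of_nat n - 1) (Polynomial.smult (lam ^ Suc n) [:- (of_nat (Suc n) * \<alpha>), 1:])"
        using comm[of 1 "int n"] unfolding Suc.IH g1
        by (simp add: pcompose_pCons algebra_simps)
      then show ?thesis using ne by (metis smult_eq_iff)
    qed (simp_all add: g0 g1 g2 \<nu>' \<gamma> power2_eq_square)
  qed (simp add: g0)
  have neg: "g (- int n) = Polynomial.smult (inverse lam ^ n) [:of_nat n * \<alpha>, 1:]" for n
  proof (induction n)
    case (Suc n)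
    consider "n = 0" | "n = 1" | "n \<ge> 2" by linarith
    then show ?case
    proof cases
      case 3
      then have ne: "(1 - of_nat n :: complex) \<noteq> 0"
        by (metis of_nat_1 of_nat_eq_iff eq_iff_diff_eq_0 Suc_1 not_less_eq_eq order_refl)
      have "Polynomial.smult (1 - of_nat n) (g (- int (Suc n))) =
          Polynomial.smult (1 - of_nat n) (Polynomial.smult (inverse lam ^ Suc n) [:of_nat (Suc n) * \<alpha>, 1:])"
        using comm[of "-1" "- int n"] unfolding Suc.IH gm1 \<beta> \<mu>'
        by (simp add: pcompose_pCons algebra_simps)
      then show ?thesis using ne by (metis smult_eq_iff)
    qed (simp_all add: g0 gm1 gm2 \<beta> \<mu>' \<pi>' \<delta> power2_eq_square)
  qed (simp add: g0)
  have "g m = Polynomial.smult (lam powi m) [:- (of_int m * \<alpha>), 1:]" for m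
    using pos[of "nat m"] neg[of "nat (- m)"]
    by (cases "m \<ge> 0") (simp_all add: power_int_def)
  then show thesis using that lam \<open>c = 0\<close> by blast
qed

section \<open>Actions of W(2,2) on C[t] in which L_0 multiplies by t\<close>

text \<open>For a = -m the hypothesis \<open>shift\<close> is the bracket [L_0, X] = m X with L_0
  acting as t, so L_m and W_m act as a shift followed by a multiplication; a = 0 covers the central
  elements.\<close>

lemma shift_intertwiner:
  fixes T :: "'a::comm_ring_1 poly \<Rightarrow> 'a poly"
  assumes add: "\<And>p q. T (p + q) = T p + T q"
    and scale: "\<And>c p. T (Polynomial.smult c p) = Polynomial.smult c (T p)"
    and shift: "\<And>p. T (pCons 0 p) = [:a, 1:] * T p"
  shows "T p = T 1 * pcompose p [:a, 1:]"
proof (induction p)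
  case 0
  show ?case using scale[of 0 0] by simp
next
  case (pCons c p)
  have "T (pCons c p) = T (Polynomial.smult c 1 + pCons 0 p)" by simp
  also have "\<dots> = Polynomial.smult c (T 1) + [:a, 1:] * T p" by (simp only: add scale shift)
  finally show ?case by (simp add: pCons.IH pcompose_pCons algebra_simps)
qed

text \<open>\<open>shift_intertwiner\<close> reduces every basis element to its value at 1, so the
  brackets become the functional equations \<open>LL\<close>, \<open>LW\<close>, \<open>WW\<close>
  for polynomials; the first is solved by \<open>virasoro_polynomials\<close>.\<close>

lemma omega_classification:
  fixes A :: "w22 \<Rightarrow> complex poly \<Rightarrow> complex poly"
  assumes add_left: "\<And>x y p. A (x + y) p = A x p + A y p"
    and scale_left: "\<And>c x p. A (w22_scale c x) p = Polynomial.smult c (A x p)"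
    and add_right: "\<And>x p q. A x (p + q) = A x p + A x q"
    and scale_right: "\<And>x c p. A x (Polynomial.smult c p) = Polynomial.smult c (A x p)"
    and bracket: "\<And>x y p. A (w22_bracket x y) p = A x (A y p) - A y (A x p)"
    and L0: "\<And>p. A (w22_basis (L 0)) p = pCons 0 p"
  obtains lam \<alpha> where "lam \<noteq> 0" "\<And>x p. A x p = act (Omega lam \<alpha>) x p"
proof -
  define B where "B = (\<lambda>i. A (w22_basis i))"
  define g where "g = (\<lambda>m. B (L m) 1)"
  define h where "h = (\<lambda>m. B (W m) 1)"
  let ?S = "\<lambda>m p. pcompose p [:- of_int m, 1 :: complex:]"
  have zero_left: "A 0 p = 0" for p
    using add_left[of 0 0 p] by simp
  have uminus_left: "A (- x) p = - A x p" for x p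
    using add_left[of x "- x" p] by (simp add: zero_left eq_neg_iff_add_eq_0 add.commute)
  have vir: "A (vir_term X D m n) p = Polynomial.smult (of_int (n - m)) (B (X (m + n)) p) +
      (if m + n = 0 then Polynomial.smult ((of_int m ^ 3 - of_int m) / 12) (B D p) else 0)" for X D m n p
    by (simp add: vir_term_def B_def add_left scale_left zero_left w22_single[of _ "of_int _"]
        w22_single[of _ "_ / _"] del: of_int_diff)
  have comm: "A (w22_basis_bracket i j) p = B i (B j p) - B j (B i p)" for i j p
    using bracket[of "w22_basis i" "w22_basis j" p] by (simp add: B_def)
  have B0: "B (L 0) p = pCons 0 p" for p by (simp add: B_def L0)
  have B_L: "B (L m) p = g m * ?S m p" for m p
    unfolding g_def
  proof (rule shift_intertwiner)
    show "B (L m) (pCons 0 p) = [:- of_int m, 1:] * B (L m) p" for p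
      using comm[of "L 0" "L m" p] by (simp add: vir B0 algebra_simps split: if_splits)
  qed (simp_all add: B_def add_right scale_right)
  have B_W: "B (W m) p = h m * ?S m p" for m p
    unfolding h_def
  proof (rule shift_intertwiner)
    show "B (W m) (pCons 0 p) = [:- of_int m, 1:] * B (W m) p" for p
      using comm[of "L 0" "W m" p] by (simp add: vir B0 algebra_simps split: if_splits)
  qed (simp_all add: B_def add_right scale_right)
  have B_C: "B D p = B D 1 * p" if "D = C\<^sub>1 \<or> D = C\<^sub>2" for D p
  proof -
    have "B D p = B D 1 * pcompose p [:0, 1:]"
    proof (rule shift_intertwiner)
      show "B D (pCons 0 p) = [:0, 1:] * B D p" for p
        using comm[of "L 0" D p] that by (auto simp: zero_left B0)
    qed (simp_all add: B_def add_right scale_right)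
    then show ?thesis by (simp add: pcompose_idR)
  qed
  have LL: "g m * ?S m (g n) - g n * ?S n (g m) =
      Polynomial.smult (of_int (n - m)) (g (m + n)) +
      (if m + n = 0 then Polynomial.smult ((of_int m ^ 3 - of_int m) / 12) (B C\<^sub>1 1) else 0)" for m n
    using comm[of "L m" "L n" 1] 
    unfolding w22_basis_bracket.simps vir B_L[of m "B (L n) 1"] B_L[of n "B (L m) 1"] g_def
    by (rule sym)
  have LW: "g m * ?S m (h n) - h n * ?S n (g m) =
      Polynomial.smult (of_int (n - m)) (h (m + n)) +
      (if m + n = 0 then Polynomial.smult ((of_int m ^ 3 - of_int m) / 12) (B C\<^sub>2 1) else 0)" for m n
    using comm[of "L m" "W n" 1] 
    unfolding w22_basis_bracket.simps vir B_L[of m "B (W n) 1"] B_W[of n "B (L m) 1"] g_def h_def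
    by (rule sym)
  have WW: "h m * ?S m (h n) = h n * ?S n (h m)" for m n
    using comm[of "W m" "W n" 1]
    by (simp add: B_W[of m "B (W n) 1"] B_W[of n "B (W m) 1"] zero_left) (simp add: h_def)
  obtain lam \<alpha> where lam: "lam \<noteq> 0" and C1: "B C\<^sub>1 1 = 0"
    and g: "\<And>m. g m = Polynomial.smult (lam powi m) [:- (of_int m * \<alpha>), 1:]"
    using virasoro_polynomials[of g "B C\<^sub>1 1"] LL B0 unfolding g_def
    by (metis one_pCons)
  have g_nz: "g m \<noteq> 0" for m
    using lam by (simp add: g)
  have h0: "degree (h 0) = 0"
  proof -
    have "h 1 = g 1 * (h 0 - ?S 1 (h 0))"
      using LW[of 1 0] by (simp add: algebra_simps) 
    moreover have "h 1 * (h 0 - ?S 1 (h 0)) = 0"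
      using WW[of 1 0] by (auto simp: algebra_simps pcompose_idR)
    ultimately have "h 0 - ?S 1 (h 0) = 0"
      using g_nz[of 1] by auto
    then show ?thesis
      using shift_periodic_imp_const[of "h 0" "- 1"] by simp
  qed
  \<comment> \<open>For constant h_0 the left side of \<open>LW\<close> at (m, 0) vanishes, while
    the right side is - m h_m.\<close>
  have h_nz: "h m = 0" if "m \<noteq> 0" for m
  proof -
    obtain b where "h 0 = [:b:]" using h0 degree_eq_zeroE by blast
    then show ?thesis using LW[of m 0] that by (simp add: pcompose_pCons)
  qed
  \<comment> \<open>The central coefficient is 0 at (1, -1), so only - 2 h_0 remains; the pair (2,
    -2) then isolates C_2.\<close>
  have h_z: "h 0 = 0"
    using LW[of 1 "- 1"] by (simp add: h_nz)
  have C2: "B C\<^sub>2 1 = 0"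
    using LW[of 2 "- 2"] by (simp add: h_nz h_z)
  have "B i p = omega_basis_act lam \<alpha> i p" for i p
  proof (cases i)
    case (L m)
    then show ?thesis by (simp add: B_L g omega_basis_act_def smult_diff_right)
  next
    case (W m)
    then show ?thesis using h_nz[of m] h_z by (cases "m = 0") (simp_all add: B_W omega_basis_act_def)
  next
    case C\<^sub>1
    then show ?thesis using B_C[of i p] C1 by (simp add: omega_basis_act_def)
  next
    case C\<^sub>2
    then show ?thesis using B_C[of i p] C2 by (simp add: omega_basis_act_def)
  qed
  then have "A x p = act (Omega lam \<alpha>) x p" for x p
    by (induction x rule: w22_induct)
      (simp_all add: zero_left omega_act_zero add_left scale_left omega_act_linear omega_act_basis B_def)
  with lam that show thesis by blast
qed

section \<open>Modules over enveloping algebras\<close>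

lemma free_algebra_simps [simp]:
  "carrier (free_algebra UNIV) = UNIV"
  "p \<otimes>\<^bsub>free_algebra g\<^esub> q = p * q"
  "p \<oplus>\<^bsub>free_algebra g\<^esub> q = p + q"
  "\<one>\<^bsub>free_algebra g\<^esub> = 1"
  "\<zero>\<^bsub>free_algebra g\<^esub> = 0"
  by (simp_all add: free_algebra_def)

lemma free_algebra_a_inv [simp]:
  assumes "p \<in> carrier (free_algebra g)"
  shows "\<ominus>\<^bsub>free_algebra g\<^esub> p = - p"
proof -
  interpret F: ring "free_algebra g" by (rule ring_free_algebra)
  have "- p \<in> carrier (free_algebra g)"
    using assms by (simp add: free_algebra_def in_keys_iff)
  then show ?thesis using assms by (intro F.minus_equality) simp_all
qed

lemma free_algebra_memI:
  "gen x \<in> carrier (free_algebra g) \<longleftrightarrow> x \<in> g"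
  "const c \<in> carrier (free_algebra g)"
  by (simp_all add: free_algebra_def gen_def const_def zero_word_def)

lemma free_algebra_induct [consumes 1, case_names zero add word]:
  assumes "q \<in> carrier (free_algebra g)"
    and zero: "P 0"
    and add: "\<And>p q. P p \<Longrightarrow> P q \<Longrightarrow> P (p + q)"
    and word: "\<And>c ws. set ws \<subseteq> g \<Longrightarrow> P (Poly_Mapping.single (Word ws) c)"
  shows "P q"
  using assms(1)
proof (induction q rule: update_induct)
  case const
  show ?case by (rule zero)
next
  case (update f a b)
  have eq: "Poly_Mapping.update a b f = f + Poly_Mapping.single a b"
    using update by (intro poly_mapping_eqI)
      (auto simp: lookup_add lookup_update lookup_single when_def in_keys_iff)
  have "Poly_Mapping.keys (Poly_Mapping.update a b f) = insert a (Poly_Mapping.keys f)"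
    using update(2) by (auto simp: in_keys_iff lookup_update split: if_splits)
  then have "f \<in> carrier (free_algebra g)" "set (letters a) \<subseteq> g"
    using update.prems by (simp_all add: free_algebra_def)
  then show ?case
    unfolding eq using add update.IH word[of "letters a" b] by simp
qed

lemma single_word_Cons: "Poly_Mapping.single (Word (x # ws)) c = gen x * Poly_Mapping.single (Word ws) c"
  by (simp add: gen_def mult_single plus_word_def)

lemma single_word_Nil: "Poly_Mapping.single (Word []) c = const c"
  by (simp add: const_def zero_word_def)

section \<open>The enveloping ideal and its cosets\<close>

context lie_algebra
begin

lemma ideal_enveloping:
  assumes "subspace g" "\<And>x y. x \<in> g \<Longrightarrow> y \<in> g \<Longrightarrow> bracket x y \<in> g"
  shows "ideal (enveloping_ideal g) (free_algebra g)"
  unfolding enveloping_ideal_def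
  by (intro ring.genideal_ideal ring_free_algebra enveloping_relations_closed assms)

lemma ideal_enveloping_UNIV: "ideal (enveloping_ideal UNIV) (free_algebra UNIV)"
  by (rule ideal_enveloping) simp_all

lemma enveloping_ideal_closed:
  assumes "subspace g" "\<And>x y. x \<in> g \<Longrightarrow> y \<in> g \<Longrightarrow> bracket x y \<in> g"
  shows "0 \<in> enveloping_ideal g"
    "p \<in> enveloping_ideal g \<Longrightarrow> q \<in> enveloping_ideal g \<Longrightarrow> p + q \<in> enveloping_ideal g"
proof -
  interpret additive_subgroup "enveloping_ideal g" "free_algebra g"
    by (rule ideal.axioms(1)) (rule ideal_enveloping[OF assms])
  show "0 \<in> enveloping_ideal g"
    using zero_closed by simp
  show "p + q \<in> enveloping_ideal g" if "p \<in> enveloping_ideal g" "q \<in> enveloping_ideal g"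
    using a_closed[OF that] by simp
qed

lemma enveloping_relations_subset:
  assumes "subspace g" "\<And>x y. x \<in> g \<Longrightarrow> y \<in> g \<Longrightarrow> bracket x y \<in> g"
  shows "enveloping_relations g \<subseteq> enveloping_ideal g"
  unfolding enveloping_ideal_def
  by (intro ring.genideal_self ring_free_algebra enveloping_relations_closed assms)

text \<open>The ideal for the whole Lie algebra, cut down to \<open>free_algebra g\<close>, is an
  ideal there and contains the relations of \<open>g\<close>; minimality of the generated ideal
  concludes.\<close>

lemma enveloping_ideal_mono:
  assumes "subspace g" "\<And>x y. x \<in> g \<Longrightarrow> y \<in> g \<Longrightarrow> bracket x y \<in> g"
  shows "enveloping_ideal g \<subseteq> enveloping_ideal UNIV"
proof -
  interpret F: ring "free_algebra g" by (rule ring_free_algebra)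
  interpret I: ideal "enveloping_ideal UNIV" "free_algebra UNIV" by (rule ideal_enveloping_UNIV)
  let ?J = "enveloping_ideal UNIV \<inter> carrier (free_algebra g)"
  have "ideal ?J (free_algebra g)"
  proof (rule idealI[OF ring_free_algebra])
    show "subgroup ?J (add_monoid (free_algebra g))"
    proof (rule F.add.subgroupI)
      show "?J \<noteq> {}" using enveloping_ideal_closed(1)[of UNIV] F.zero_closed by auto
      fix p q assume "p \<in> ?J" "q \<in> ?J"
      then show "p \<oplus>\<^bsub>free_algebra g\<^esub> q \<in> ?J"
        using enveloping_ideal_closed(2)[of UNIV p q] F.a_closed[of p q] by simp
      show "\<ominus>\<^bsub>free_algebra g\<^esub> p \<in> ?J"
        using I.I_l_closed[of p "- 1"] F.a_inv_closed[of p] \<open>p \<in> ?J\<close> by simp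
    qed auto
    fix p q assume pq: "p \<in> ?J" "q \<in> carrier (free_algebra g)"
    show "q \<otimes>\<^bsub>free_algebra g\<^esub> p \<in> ?J"
      using I.I_l_closed[of p q] F.m_closed[of q p] pq by simp
    show "p \<otimes>\<^bsub>free_algebra g\<^esub> q \<in> ?J"
      using I.I_r_closed[of p q] F.m_closed[of p q] pq by simp
  qed
  moreover have "enveloping_relations g \<subseteq> enveloping_relations UNIV"
    unfolding enveloping_relations_def by blast
  then have "enveloping_relations g \<subseteq> ?J"
    using enveloping_relations_subset[of UNIV] enveloping_relations_closed[OF assms] by simp
  ultimately show ?thesis
    using F.genideal_minimal[of ?J "enveloping_relations g"]
    unfolding enveloping_ideal_def by blast
qed

lemma enveloping_proj_eq_iff:
  assumes "subspace g" "\<And>x y. x \<in> g \<Longrightarrow> y \<in> g \<Longrightarrow> bracket x y \<in> g"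
    and "p \<in> carrier (free_algebra g)" "q \<in> carrier (free_algebra g)"
  shows "enveloping_proj g p = enveloping_proj g q \<longleftrightarrow> p - q \<in> enveloping_ideal g"
proof -
  interpret I: ideal "enveloping_ideal g" "free_algebra g"
    by (rule ideal_enveloping) (use assms in auto)
  show ?thesis
    using I.quotient_eq_iff_same_a_r_cos[OF I.is_ideal assms(3,4)] assms(3,4)
    by (simp add: enveloping_proj_def a_minus_def)
qed

lemma carrier_enveloping: "carrier (enveloping g) = enveloping_proj g ` carrier (free_algebra g)"
  by (auto simp: enveloping_def FactRing_def A_RCOSETS_def' enveloping_proj_def)

text \<open>Write I for the ideal of the whole algebra and J for that of \<open>g\<close>. As J lies
  in I and contains 0, I + (J + q) = I + q: adding I to a coset is the induced map.\<close>

lemma enveloping_inclusion_proj: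
  assumes "subspace g" "\<And>x y. x \<in> g \<Longrightarrow> y \<in> g \<Longrightarrow> bracket x y \<in> g"
    and "q \<in> carrier (free_algebra g)"
  shows "enveloping_inclusion UNIV (enveloping_proj g q) = enveloping_proj UNIV q"
proof -
  interpret I: ideal "enveloping_ideal UNIV" "free_algebra UNIV" by (rule ideal_enveloping_UNIV)
  have add: "p + p' \<in> enveloping_ideal UNIV" if "p \<in> enveloping_ideal UNIV" "p' \<in> enveloping_ideal g" for p p'
    using enveloping_ideal_closed(2)[of UNIV p p'] that enveloping_ideal_mono[OF assms(1,2)] by auto
  have z: "0 \<in> enveloping_ideal g" by (rule enveloping_ideal_closed) (use assms in auto)
  show ?thesis
    unfolding enveloping_inclusion_def enveloping_proj_def set_add_def' a_r_coset_def'
    using add z by (auto simp flip: add.assoc)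
qed

lemma enveloping_proj_hom:
  "enveloping_proj UNIV (p + q) = enveloping_proj UNIV p \<oplus>\<^bsub>enveloping UNIV\<^esub> enveloping_proj UNIV q"
  "enveloping_proj UNIV (p * q) = enveloping_proj UNIV p \<otimes>\<^bsub>enveloping UNIV\<^esub> enveloping_proj UNIV q"
  "enveloping_proj UNIV 1 = \<one>\<^bsub>enveloping UNIV\<^esub>"
proof -
  interpret I: ideal "enveloping_ideal UNIV" "free_algebra UNIV" by (rule ideal_enveloping_UNIV)
  interpret h: ring_hom_ring "free_algebra UNIV" "enveloping UNIV" "enveloping_proj UNIV"
    using I.rcos_ring_hom_ring unfolding enveloping_def enveloping_proj_def[abs_def] .
  show "enveloping_proj UNIV (p + q) = enveloping_proj UNIV p \<oplus>\<^bsub>enveloping UNIV\<^esub> enveloping_proj UNIV q"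
    "enveloping_proj UNIV (p * q) = enveloping_proj UNIV p \<otimes>\<^bsub>enveloping UNIV\<^esub> enveloping_proj UNIV q"
    "enveloping_proj UNIV 1 = \<one>\<^bsub>enveloping UNIV\<^esub>"
    using h.hom_add[of p q] h.hom_mult[of p q] h.hom_one by simp_all
qed

end

lemma const_simps:
  "const (a + b) = const a + const b"
  "const (a * b) = const a * const b"
  "const 0 = 0"
  "const 1 = 1"
  by (simp_all add: const_def single_add mult_single)

lemma const_gen_commute: "const c * gen x = gen x * const c"
  by (simp add: const_def gen_def mult_single)

section \<open>Modules over U(g) through the action of the free algebra\<close>

locale enveloping_module = lie_algebra scale bracket +
    M?: left_module "lie_algebra.enveloping scale bracket UNIV" M
  for scale :: "complex \<Rightarrow> 'g::ab_group_add \<Rightarrow> 'g" and bracket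
    and M :: "(('g word \<Rightarrow>\<^sub>0 complex) set, 'm) module" (structure)
begin

text \<open>Elements of the free algebra act through their cosets, so that one computes with
  representatives; the enveloping relations enter through \<open>ap_cong\<close>.\<close>

definition ap :: "('g word \<Rightarrow>\<^sub>0 complex) \<Rightarrow> 'm \<Rightarrow> 'm" where
  "ap p v = enveloping_proj UNIV p \<odot>\<^bsub>M\<^esub> v"

lemma enveloping_proj_closed: "enveloping_proj UNIV p \<in> carrier (enveloping UNIV)"
  by (simp add: carrier_enveloping)

lemma ap_closed: "v \<in> carrier M \<Longrightarrow> ap p v \<in> carrier M"
  by (simp add: ap_def smult_closed enveloping_proj_closed)

lemma ap_add_left: "v \<in> carrier M \<Longrightarrow> ap (p + q) v = ap p v \<oplus>\<^bsub>M\<^esub> ap q v"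
  by (simp add: ap_def smult_l_distr enveloping_proj_closed enveloping_proj_hom)

lemma ap_add_right:
  "v \<in> carrier M \<Longrightarrow> w \<in> carrier M \<Longrightarrow> ap p (v \<oplus>\<^bsub>M\<^esub> w) = ap p v \<oplus>\<^bsub>M\<^esub> ap p w"
  by (simp add: ap_def smult_r_distr enveloping_proj_closed)

lemma ap_mult: "v \<in> carrier M \<Longrightarrow> ap (p * q) v = ap p (ap q v)"
  by (simp add: ap_def smult_assoc enveloping_proj_closed enveloping_proj_hom)

lemma ap_one: "v \<in> carrier M \<Longrightarrow> ap 1 v = v"
  by (simp add: ap_def smult_one enveloping_proj_hom)

lemma ap_zero_left: "v \<in> carrier M \<Longrightarrow> ap 0 v = \<zero>\<^bsub>M\<^esub>"
  using ap_add_left[of v 0 0] ap_closed[of v 0] by simp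

lemma ap_uminus_one:
  assumes "v \<in> carrier M"
  shows "ap (const (- 1)) v = \<ominus>\<^bsub>M\<^esub> v"
proof -
  have z: "const (- 1) + const 1 = (0 :: 'g word \<Rightarrow>\<^sub>0 complex)"
    by (simp add: const_simps(3) flip: const_simps(1))
  have "ap (const (- 1)) v \<oplus>\<^bsub>M\<^esub> v = ap (const (- 1) + const 1) v"
    using assms by (simp add: ap_add_left const_simps ap_one)
  also have "\<dots> = \<zero>\<^bsub>M\<^esub>"
    using assms by (simp only: z ap_zero_left)
  finally show ?thesis
    using assms by (simp add: M.minus_equality ap_closed)
qed

lemma ap_cong:
  assumes "p - q \<in> enveloping_relations UNIV"
  shows "ap p v = ap q v"
proof -
  have "p - q \<in> enveloping_ideal UNIV"
    using assms enveloping_relations_subset[of UNIV] by auto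
  then show ?thesis
    using enveloping_proj_eq_iff[of UNIV p q] by (simp add: ap_def)
qed

lemma ap_gen_add: "v \<in> carrier M \<Longrightarrow> ap (gen (x + y)) v = ap (gen x) v \<oplus>\<^bsub>M\<^esub> ap (gen y) v"
  by (subst ap_cong[of _ "gen x + gen y"]) (auto simp: enveloping_relations_def ap_add_left)

lemma ap_gen_scale: "v \<in> carrier M \<Longrightarrow> ap (gen (scale c x)) v = ap (const c) (ap (gen x) v)"
  by (subst ap_cong[of _ "const c * gen x"]) (auto simp: enveloping_relations_def ap_mult)

text \<open>Kept free of subtraction in \<open>M\<close> by regrouping the relation as
  \<open>gen x * gen y - (gen y * gen x + gen (bracket x y))\<close>.\<close>

lemma ap_gen_bracket:
  assumes "v \<in> carrier M"
  shows "ap (gen (bracket x y)) v \<oplus>\<^bsub>M\<^esub> ap (gen y) (ap (gen x) v) = ap (gen x) (ap (gen y) v)"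
proof -
  have "gen x * gen y - (gen y * gen x + gen (bracket x y)) \<in> enveloping_relations UNIV"
    unfolding enveloping_relations_def diff_diff_eq[symmetric] by blast
  from ap_cong[OF this, of v] show ?thesis
    using assms by (simp add: ap_add_left ap_mult ap_closed M.a_comm)
qed

lemma ap_const_gen: "v \<in> carrier M \<Longrightarrow> ap (gen x) (ap (const c) v) = ap (const c) (ap (gen x) v)"
  by (simp add: const_gen_commute flip: ap_mult)

text \<open>Each element is a sum of scalar multiples of words, and letters are peeled off from the
  left until only the scalar remains. The set \<open>g\<close> is \<open>UNIV\<close> when
  submodules of \<open>M\<close> are described, and a line when the multiples of a basis vector
  are.\<close>

lemma ap_in_invariant:
  assumes N: "N \<subseteq> carrier M" "\<zero>\<^bsub>M\<^esub> \<in> N" "\<And>v w. v \<in> N \<Longrightarrow> w \<in> N \<Longrightarrow> v \<oplus>\<^bsub>M\<^esub> w \<in> N"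
      "\<And>c v. v \<in> N \<Longrightarrow> ap (const c) v \<in> N" "\<And>x v. x \<in> g \<Longrightarrow> v \<in> N \<Longrightarrow> ap (gen x) v \<in> N"
    and "q \<in> carrier (free_algebra g)" "v \<in> N"
  shows "ap q v \<in> N"
proof -
  have v: "v \<in> carrier M" using assms by blast
  have word: "ap (Poly_Mapping.single (Word ws) c) v \<in> N" if "set ws \<subseteq> g" for ws c
    using that
  proof (induction ws)
    case Nil
    then show ?case using assms by (simp add: single_word_Nil)
  next
    case (Cons x ws)
    then show ?case using N(5) v by (simp add: single_word_Cons ap_mult)
  qed
  show ?thesis
    using assms(6) by (induction q rule: free_algebra_induct) (simp_all add: ap_zero_left v N ap_add_left word)
qed

text \<open>Scalars and generators generate the enveloping algebra, and the scalar -1 supplies the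
  negatives that a subgroup needs. Simplicity thus becomes a question about invariant
  subspaces.\<close>

lemma submodule_iff_invariant:
  "submodule N (enveloping UNIV) M \<longleftrightarrow>
     N \<subseteq> carrier M \<and> \<zero>\<^bsub>M\<^esub> \<in> N \<and> (\<forall>v\<in>N. \<forall>w\<in>N. v \<oplus>\<^bsub>M\<^esub> w \<in> N) \<and>
     (\<forall>c. \<forall>v\<in>N. ap (const c) v \<in> N) \<and> (\<forall>x. \<forall>v\<in>N. ap (gen x) v \<in> N)"
  (is "_ \<longleftrightarrow> ?inv")
proof
  assume "submodule N (enveloping UNIV) M"
  then interpret N: submodule N "enveloping UNIV" M .
  show ?inv
    using N.subset N.one_closed N.m_closed N.smult_closed[OF enveloping_proj_closed]
    by (auto simp: ap_def)
next
  assume inv: ?inv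
  have "ap q v \<in> N" if "v \<in> N" for q v
    by (rule ap_in_invariant[of N UNIV]) (use inv that in auto)
  then have closed: "a \<odot>\<^bsub>M\<^esub> v \<in> N" if "a \<in> carrier (enveloping UNIV)" "v \<in> N" for a v
    using that by (auto simp: carrier_enveloping ap_def)
  have "subgroup N (add_monoid M)"
  proof (rule M.add.subgroupI)
    show "\<ominus>\<^bsub>M\<^esub> v \<in> N" if "v \<in> N" for v
      using inv that ap_uminus_one[of v] by (metis subsetD)
  qed (use inv in auto)
  then show "submodule N (enveloping UNIV) M"
    by (intro submodule.intro submodule_axioms.intro closed)
qed

end

section \<open>The enveloping algebra of a line\<close>

text \<open>The algebra homomorphism to C[t] that extends \<rho> from the generators. It serves to
  show that distinct polynomials in z stay distinct in U(Cz).\<close>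

definition free_eval :: "('g \<Rightarrow> complex poly) \<Rightarrow> ('g word \<Rightarrow>\<^sub>0 complex) \<Rightarrow> complex poly" where
  "free_eval \<rho> q = (\<Sum>w\<in>Poly_Mapping.keys q.
     Polynomial.smult (Poly_Mapping.lookup q w) (prod_list (map \<rho> (letters w))))"

lemma free_eval_superset:
  assumes "finite A" "Poly_Mapping.keys q \<subseteq> A"
  shows "free_eval \<rho> q =
    (\<Sum>w\<in>A. Polynomial.smult (Poly_Mapping.lookup q w) (prod_list (map \<rho> (letters w))))"
  unfolding free_eval_def using assms by (intro sum.mono_neutral_left) (auto simp: in_keys_iff)

lemma free_eval_add: "free_eval \<rho> (p + q) = free_eval \<rho> p + free_eval \<rho> q"
  using keys_add[of p q]
  by (simp add: free_eval_superset[of "Poly_Mapping.keys p \<union> Poly_Mapping.keys q"] lookup_add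
      smult_add_left sum.distrib)

lemma free_eval_single:
  "free_eval \<rho> (Poly_Mapping.single w c) = Polynomial.smult c (prod_list (map \<rho> (letters w)))"
  by (simp add: free_eval_superset[of "{w}"])

lemma letters_zero [simp]: "letters 0 = []"
  by (simp add: zero_word_def)

lemma free_eval_simps [simp]:
  "free_eval \<rho> 0 = 0" "free_eval \<rho> 1 = 1"
  "free_eval \<rho> (gen x) = \<rho> x" "free_eval \<rho> (const c) = [:c:]"
  using free_eval_single[of \<rho> 0 1]
  by (simp_all add: free_eval_def[of _ 0] gen_def const_def free_eval_single)

lemma free_eval_uminus: "free_eval \<rho> (- p) = - free_eval \<rho> p"
  using free_eval_add[of \<rho> p "- p"] by (simp add: eq_neg_iff_add_eq_0 add.commute)

lemma free_eval_diff: "free_eval \<rho> (p - q) = free_eval \<rho> p - free_eval \<rho> q"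
  using free_eval_add[of \<rho> p "- q"] by (simp add: free_eval_uminus)

lemma free_eval_mult: "free_eval \<rho> (p * q) = free_eval \<rho> p * free_eval \<rho> q"
proof -
  have single: "free_eval \<rho> (Poly_Mapping.single (Word v) c * q) =
      free_eval \<rho> (Poly_Mapping.single (Word v) c) * free_eval \<rho> q" for v c
  proof -
    have "q \<in> carrier (free_algebra UNIV)" by simp
    then show ?thesis
      by (induction q rule: free_algebra_induct)
        (simp_all add: free_eval_add distrib_left mult_single free_eval_single plus_word_def
          mult.commute)
  qed
  have "p \<in> carrier (free_algebra UNIV)" by simp
  then show ?thesis
    by (induction p rule: free_algebra_induct) (simp_all add: free_eval_add distrib_right single)
qed

text \<open>Substitution of the generator \<open>x\<close> for t by Horner's scheme; when
  \<open>\<rho> x\<close> is t, it is a right inverse of \<open>free_eval \<rho>\<close>.\<close>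

definition poly_gen :: "'g \<Rightarrow> complex poly \<Rightarrow> 'g word \<Rightarrow>\<^sub>0 complex" where
  "poly_gen x p = fold_coeffs (\<lambda>a q. const a + gen x * q) p 0"

lemma poly_gen_0 [simp]: "poly_gen x 0 = 0"
  by (simp add: poly_gen_def)

lemma poly_gen_pCons: "poly_gen x (pCons a p) = const a + gen x * poly_gen x p"
  by (cases "a = 0 \<and> p = 0") (auto simp: poly_gen_def const_simps)

lemma poly_gen_add: "poly_gen x (p + q) = poly_gen x p + poly_gen x q"
  by (induction p q rule: poly_induct2) (simp_all add: poly_gen_pCons const_simps algebra_simps)

lemma poly_gen_smult: "poly_gen x (Polynomial.smult c p) = const c * poly_gen x p"
  by (induction p)
    (simp_all add: poly_gen_pCons const_simps distrib_left const_gen_commute flip: mult.assoc)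

lemma poly_gen_closed: "x \<in> g \<Longrightarrow> poly_gen x p \<in> carrier (free_algebra g)"
proof (induction p)
  case (pCons a p)
  interpret F: ring "free_algebra g" by (rule ring_free_algebra)
  show ?case
    using F.a_closed[of "const a" "gen x * poly_gen x p"] F.m_closed[of "gen x" "poly_gen x p"]
      pCons by (simp add: poly_gen_pCons free_algebra_memI)
qed (simp add: free_algebra_def)

lemma free_eval_poly_gen: "\<rho> x = [:0, 1:] \<Longrightarrow> free_eval \<rho> (poly_gen x p) = p"
  by (induction p) (simp_all add: poly_gen_pCons free_eval_add free_eval_mult)

context lie_algebra
begin

lemma bracket_span_singleton:
  assumes "x \<in> span {z}" "y \<in> span {z}"
  shows "bracket x y = 0"
  using assms by (auto simp: span_singleton bracket_scale_left bracket_scale_right bracket_self)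

text \<open>The kernel of the evaluation z = t is an ideal, and it contains the relations of the
  line because C[t] is commutative and the bracket vanishes there. So the evaluation factors through
  U(Cz).\<close>

lemma enveloping_line_eval:
  assumes "z \<noteq> 0"
  obtains \<rho> where "\<rho> z = [:0, 1:]" "\<And>q. q \<in> enveloping_ideal (span {z}) \<Longrightarrow> free_eval \<rho> q = 0"
proof -
  \<comment> \<open>The coordinate of \<open>x\<close> with respect to \<open>z\<close>, unique as
    \<open>z\<close> is nonzero. Off the line the value is unspecified, but no relation of
    \<open>span {z}\<close> involves such letters.\<close>
  define \<rho> where "\<rho> x = [:0, THE k. x = scale k z:]" for x
  let ?h = "span {z}"
  interpret F: ring "free_algebra ?h" by (rule ring_free_algebra)
  have \<rho>: "\<rho> (scale k z) = [:0, k:]" for k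
    unfolding \<rho>_def using assms by (subst the_equality[of _ k]) auto
  have rel: "free_eval \<rho> q = 0" if q: "q \<in> enveloping_relations ?h" for q
  proof -
    \<comment> \<open>On the line the bracket relation contains \<open>gen 0\<close>, which must be
      sent to 0.\<close>
    have "\<rho> 0 = 0" using \<rho>[of 0] by simp
    with q show ?thesis
      unfolding enveloping_relations_def
      by (auto simp: bracket_span_singleton free_eval_diff free_eval_add free_eval_mult)
        (auto simp: span_singleton \<rho> simp flip: scale_left_distrib)
  qed
  let ?K = "{q \<in> carrier (free_algebra ?h). free_eval \<rho> q = 0}"
  have "ideal ?K (free_algebra ?h)"
  proof (rule idealI[OF ring_free_algebra])
    show "subgroup ?K (add_monoid (free_algebra ?h))"
    proof (rule F.add.subgroupI)
      show "?K \<noteq> {}" using F.zero_closed by (auto intro!: exI[of _ 0])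
      fix p q assume "p \<in> ?K" "q \<in> ?K"
      then show "p \<oplus>\<^bsub>free_algebra ?h\<^esub> q \<in> ?K"
        using F.a_closed[of p q] by (simp add: free_eval_add)
      show "\<ominus>\<^bsub>free_algebra ?h\<^esub> p \<in> ?K"
        using F.a_inv_closed[of p] \<open>p \<in> ?K\<close> by (simp add: free_eval_uminus)
    qed auto
    fix p q assume pq: "p \<in> ?K" "q \<in> carrier (free_algebra ?h)"
    show "q \<otimes>\<^bsub>free_algebra ?h\<^esub> p \<in> ?K"
      using F.m_closed[of q p] pq by (simp add: free_eval_mult)
    show "p \<otimes>\<^bsub>free_algebra ?h\<^esub> q \<in> ?K"
      using F.m_closed[of p q] pq by (simp add: free_eval_mult)
  qed
  moreover have "enveloping_relations ?h \<subseteq> ?K"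
    using enveloping_relations_closed[of ?h] rel
    by (auto simp: bracket_span_singleton span_zero)
  ultimately have "enveloping_ideal ?h \<subseteq> ?K"
    unfolding enveloping_ideal_def by (rule F.genideal_minimal)
  then show thesis
    using that[of \<rho>] \<rho>[of 1] by auto
qed

end

context enveloping_module
begin

text \<open>In effect U(Cz) = C[z]: the evaluation makes p -> p(z) b injective, and its range is all
  of \<open>M\<close> because it contains b and is stable under sums, scalars and z.\<close>

lemma free_of_rank_one_line:
  assumes "z \<noteq> 0"
    and "free_of_rank_one (enveloping (span {z})) (restrict_scalars (enveloping_inclusion UNIV) M)"
  obtains b where "b \<in> carrier M" "bij_betw (\<lambda>p. ap (poly_gen z p) b) UNIV (carrier M)"
proof -
  let ?h = "span {z}"
  have sub: "subspace ?h" and br: "\<And>x y. x \<in> ?h \<Longrightarrow> y \<in> ?h \<Longrightarrow> bracket x y \<in> ?h"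
    by (simp_all add: bracket_span_singleton span_zero)
  have z: "z \<in> ?h" by (simp add: span_base)
  obtain b where b: "b \<in> carrier M"
    and bij: "bij_betw (\<lambda>r. enveloping_inclusion UNIV r \<odot>\<^bsub>M\<^esub> b) (carrier (enveloping ?h)) (carrier M)"
    using assms(2) by (auto simp: free_of_rank_one_def restrict_scalars_def)
  let ?\<psi> = "\<lambda>p. ap (poly_gen z p) b"
  have incl: "enveloping_inclusion UNIV (enveloping_proj ?h q) \<odot>\<^bsub>M\<^esub> b = ap q b"
    if "q \<in> carrier (free_algebra ?h)" for q
    by (simp add: ap_def enveloping_inclusion_proj[OF sub br that])
  have "inj ?\<psi>"
  proof (rule injI)
    fix p q assume "?\<psi> p = ?\<psi> q"
    then have "enveloping_proj ?h (poly_gen z p) = enveloping_proj ?h (poly_gen z q)"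
      using poly_gen_closed[OF z]
      by (intro inj_onD[OF bij_betw_imp_inj_on[OF bij]]) (simp_all add: incl carrier_enveloping)
    then have "poly_gen z p - poly_gen z q \<in> enveloping_ideal ?h"
      using enveloping_proj_eq_iff[OF sub br poly_gen_closed[OF z] poly_gen_closed[OF z]] by blast
    then show "p = q"
      using enveloping_line_eval[OF assms(1)] free_eval_poly_gen free_eval_diff
      by (metis eq_iff_diff_eq_0)
  qed
  moreover have "v \<in> range ?\<psi>" if v: "v \<in> carrier M" for v
  proof -
    have "carrier M = (\<lambda>q. ap q b) ` carrier (free_algebra ?h)"
      unfolding bij_betw_imp_surj_on[OF bij, symmetric] carrier_enveloping image_image
      by (rule image_cong) (simp_all add: incl)
    then obtain q where q: "q \<in> carrier (free_algebra ?h)" and "v = ap q b"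
      using v by blast
    moreover have "ap q b \<in> range ?\<psi>"
    proof (rule ap_in_invariant[OF _ _ _ _ _ q])
      show "range ?\<psi> \<subseteq> carrier M" using b by (auto simp: ap_closed)
      show "\<zero>\<^bsub>M\<^esub> \<in> range ?\<psi>"
        using b by (auto simp: image_iff ap_zero_left intro!: exI[of _ 0])
      show "b \<in> range ?\<psi>"
        using b by (auto simp: image_iff poly_gen_pCons const_simps ap_one one_pCons intro!: exI[of _ 1])
      fix v w assume "v \<in> range ?\<psi>" "w \<in> range ?\<psi>"
      then show "v \<oplus>\<^bsub>M\<^esub> w \<in> range ?\<psi>"
        using b by (auto simp flip: ap_add_left poly_gen_add)
    next
      fix c v assume "v \<in> range ?\<psi>"
      then show "ap (const c) v \<in> range ?\<psi>"
        using b by (auto simp flip: ap_mult poly_gen_smult)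
    next
      fix x v assume "x \<in> ?h" "v \<in> range ?\<psi>"
      then obtain k p where x: "x = scale k z" and v: "v = ?\<psi> p"
        by (auto simp: span_singleton)
      have "ap (gen x) v = ?\<psi> (Polynomial.smult k (pCons 0 p))"
        unfolding poly_gen_smult poly_gen_pCons x v using b
        by (simp add: ap_gen_scale ap_closed ap_mult const_simps)
      then show "ap (gen x) v \<in> range ?\<psi>" by blast
    qed
    ultimately show ?thesis by simp
  qed
  ultimately have "bij_betw ?\<psi> UNIV (carrier M)"
    using b by (auto simp: bij_betw_def ap_closed)
  with b show thesis by (rule that)
qed

end

section \<open>Classification and simplicity\<close>

text \<open>The submodules of \<open>Omega lam \<alpha>\<close>, in the shape of
  \<open>submodule_iff_invariant\<close> so that images of submodules of \<open>M\<close> match it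
  clause by clause.\<close>

definition omega_invariant :: "complex \<Rightarrow> complex \<Rightarrow> complex poly set \<Rightarrow> bool" where
  "omega_invariant lam \<alpha> P \<longleftrightarrow> 0 \<in> P \<and> (\<forall>f\<in>P. \<forall>g\<in>P. f + g \<in> P) \<and>
     (\<forall>c. \<forall>f\<in>P. Polynomial.smult c f \<in> P) \<and> (\<forall>x. \<forall>f\<in>P. act (Omega lam \<alpha>) x f \<in> P)"

lemma omega_invariant_UNIV:
  assumes P: "omega_invariant lam \<alpha> P" and "lam \<noteq> 0" "\<alpha> \<noteq> 0" "f\<^sub>0 \<in> P" "f\<^sub>0 \<noteq> 0"
  shows "P = UNIV"
proof -
  have add: "f + g \<in> P" if "f \<in> P" "g \<in> P" for f g
    using P that by (simp add: omega_invariant_def)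
  have scale: "Polynomial.smult c f \<in> P" if "f \<in> P" for c f
    using P that by (simp add: omega_invariant_def)
  have basis: "omega_basis_act lam \<alpha> i f \<in> P" if "f \<in> P" for i f
    using P that by (metis omega_invariant_def omega_act_basis)
  have ideal: "h * f \<in> P" if "f \<in> P" for h f
  proof (induction h)
    case 0
    then show ?case using P by (simp add: omega_invariant_def)
  next
    case (pCons c h)
    have "pCons 0 (h * f) \<in> P"
      using basis[OF pCons.IH, of "L 0"] by (simp add: omega_basis_act_def pcompose_idR)
    then show ?case using add scale[OF \<open>f \<in> P\<close>] by simp
  qed
  \<comment> \<open>A nonzero member of least degree, which exists because of
    \<open>f\<^sub>0\<close>; division with remainder shows that it generates the ideal
    \<open>P\<close>.\<close>
  define f where "f = arg_min degree (\<lambda>f. f \<in> P \<and> f \<noteq> 0)"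
  have f: "f \<in> P" "f \<noteq> 0" and min: "\<And>g. g \<in> P \<Longrightarrow> g \<noteq> 0 \<Longrightarrow> degree f \<le> degree g"
    using arg_min_nat_lemma[of "\<lambda>f. f \<in> P \<and> f \<noteq> 0" f\<^sub>0 degree] assms(4,5)
    by (auto simp: f_def)
  have dvd: "f dvd g" if "g \<in> P" for g
  proof -
    have "g mod f = g + (- (g div f)) * f"
      by (simp add: minus_div_mult_eq_mod[symmetric])
    then have "g mod f \<in> P"
      using add[OF that ideal[OF f(1)]] by (simp only:)
    then have "g mod f = 0"
      using min[of "g mod f"] degree_mod_less[OF f(2), of g] by fastforce
    then show ?thesis by (simp add: dvd_eq_mod_eq_0)
  qed
  have "degree f = 0"
  proof (rule ccontr)
    assume "degree f \<noteq> 0"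
    then obtain r where r: "poly f r = 0"
      using fundamental_theorem_of_algebra_alt[of f] by (metis degree_pCons_0)
    have "(r - of_int m * \<alpha>) * poly f (r - of_int m) = 0" for m
    proof -
      \<comment> \<open>L_m f lies in \<open>P\<close>, so it is divisible by f and vanishes at r;
        the nonzero factor lam^m cancels.\<close>
      obtain k where "omega_basis_act lam \<alpha> (L m) f = f * k"
        using dvd[OF basis[OF f(1)]] by blast
      then have "poly (omega_basis_act lam \<alpha> (L m) f) r = 0" using r by simp
      then show ?thesis using assms(2) by (simp add: omega_basis_act_def poly_pcompose algebra_simps)
    qed
    \<comment> \<open>With m read as a variable x, the polynomial (r - \<alpha> x) f(r - x) has
      every integer as a root, so it is 0; as \<alpha> is nonzero, f = 0 follows.\<close>
    then have "poly ([:r, - \<alpha>:] * pcompose f [:r, - 1:]) (of_int m) = 0" for m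
      by (simp add: poly_pcompose disj_commute)
    then have "range of_int \<subseteq> {x. poly ([:r, - \<alpha>:] * pcompose f [:r, - 1:]) x = 0}" by blast
    moreover have "infinite (range (of_int :: int \<Rightarrow> complex))"
      using finite_imageD[of "of_int :: int \<Rightarrow> complex" UNIV] infinite_UNIV_char_0
      by (auto simp: inj_on_def)
    ultimately have "[:r, - \<alpha>:] * pcompose f [:r, - 1:] = 0"
      using poly_roots_finite finite_subset by blast
    then have "pcompose f [:r, - 1:] = 0"
      using assms(3) by (metis mult_eq_0_iff pCons_eq_0_iff neg_equal_0_iff_equal)
    then show False using f(2) by (simp add: pcompose_eq_0_iff)
  qed
  then obtain c where c: "f = [:c:]" using degree_eq_zeroE by blast
  have "g \<in> P" for g
    using ideal[OF f(1), of "Polynomial.smult (1 / c) g"] f(2) by (simp add: c)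
  then show ?thesis by blast
qed

text \<open>At \<alpha> = 0 every L_m f carries the factor t, so vanishing at 0 is
  preserved.\<close>

lemma omega_invariant_roots: "omega_invariant lam 0 {f. poly f 0 = 0}"
proof -
  have "poly (act (Omega lam 0) x f) 0 = 0" for x f
    by (induction x rule: w22_induct)
      (auto simp: omega_act_zero omega_act_linear omega_act_basis omega_basis_act_def
        split: w22_index.split)
  then show ?thesis by (simp add: omega_invariant_def)
qed

context enveloping_module
begin

lemma underlying_rep_simps:
  "carrier (underlying_rep M) = carrier M"
  "v \<oplus>\<^bsub>underlying_rep M\<^esub> w = v \<oplus>\<^bsub>M\<^esub> w"
  "c \<odot>\<^bsub>underlying_rep M\<^esub> v = ap (const c) v"
  "act (underlying_rep M) x v = ap (gen x) v"
  by (simp_all add: underlying_rep_def ap_def)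

end

lemma Omega_simps:
  "carrier (Omega lam \<alpha>) = UNIV"
  "f \<oplus>\<^bsub>Omega lam \<alpha>\<^esub> g = f + g"
  "c \<odot>\<^bsub>Omega lam \<alpha>\<^esub> f = Polynomial.smult c f"
  by (simp_all add: Omega_def)

section \<open>Transfer between M and Omega\<close>

text \<open>For \<alpha> nonzero the image of a submodule falls under
  \<open>omega_invariant_UNIV\<close>; for \<alpha> = 0 the preimage of (t) is proper and nonzero.
  The isomorphism is arbitrary, so the criterion serves both for one found by
  \<open>omega_iso_exists\<close> and for a given one.\<close>

lemma simple_iff_omega:
  fixes M :: "((w22 word \<Rightarrow>\<^sub>0 complex) set, 'm) module"
  assumes M: "left_module (W22.enveloping UNIV) M"
    and "lam \<noteq> 0" and iso: "lie_rep_iso (W22.underlying_rep M) (Omega lam \<alpha>)"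
  shows "simple_module (W22.enveloping UNIV) M \<longleftrightarrow> \<alpha> \<noteq> 0"
proof -
  interpret enveloping_module w22_scale w22_bracket M
    by (intro enveloping_module.intro W22.lie_algebra_axioms M)
  obtain \<phi> where bij: "bij_betw \<phi> (carrier M) (UNIV :: complex poly set)"
    and add: "\<And>v w. v \<in> carrier M \<Longrightarrow> w \<in> carrier M \<Longrightarrow> \<phi> (v \<oplus>\<^bsub>M\<^esub> w) = \<phi> v + \<phi> w"
    and scale: "\<And>c v. v \<in> carrier M \<Longrightarrow> \<phi> (ap (const c) v) = Polynomial.smult c (\<phi> v)"
    and act: "\<And>x v. v \<in> carrier M \<Longrightarrow> \<phi> (ap (gen x) v) = act (Omega lam \<alpha>) x (\<phi> v)"
    using iso unfolding lie_rep_iso_def underlying_rep_simps Omega_simps by blast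
  have zero: "\<phi> \<zero>\<^bsub>M\<^esub> = 0"
    using add[of "\<zero>\<^bsub>M\<^esub>" "\<zero>\<^bsub>M\<^esub>"] by simp
  have eq_zero: "\<phi> v = 0 \<longleftrightarrow> v = \<zero>\<^bsub>M\<^esub>" if "v \<in> carrier M" for v
    using bij_betw_imp_inj_on[OF bij] that zero by (metis M.zero_closed inj_onD)
  show ?thesis
  proof
    assume simple: "simple_module (W22.enveloping UNIV) M"
    show "\<alpha> \<noteq> 0"
    proof
      assume "\<alpha> = 0"
      let ?N = "{v \<in> carrier M. poly (\<phi> v) 0 = 0}"
      have "submodule ?N (W22.enveloping UNIV) M"
        using omega_invariant_roots[of lam]
        by (auto simp: submodule_iff_invariant omega_invariant_def zero add scale act \<open>\<alpha> = 0\<close> ap_closed)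
      then have N: "?N = {\<zero>\<^bsub>M\<^esub>} \<or> ?N = carrier M"
        using simple by (simp add: simple_module_def)
      \<comment> \<open>Preimages of 1 and t witness that the submodule is neither everything nor
        zero.\<close>
      obtain v w where v: "v \<in> carrier M" "\<phi> v = 1" and w: "w \<in> carrier M" "\<phi> w = [:0, 1:]"
        using bij_betw_imp_surj_on[OF bij] by (metis (no_types, lifting) UNIV_I imageE)
      have "v \<notin> ?N" "w \<in> ?N" "w \<noteq> \<zero>\<^bsub>M\<^esub>"
        using v w zero by auto
      then show False using N v(1) by blast
    qed
  next
    assume "\<alpha> \<noteq> 0"
    have "N = {\<zero>\<^bsub>M\<^esub>} \<or> N = carrier M" if "submodule N (W22.enveloping UNIV) M" for N
    proof (rule disjCI)
      assume "N \<noteq> carrier M"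
      have N: "N \<subseteq> carrier M" "\<zero>\<^bsub>M\<^esub> \<in> N" "\<And>v w. v \<in> N \<Longrightarrow> w \<in> N \<Longrightarrow> v \<oplus>\<^bsub>M\<^esub> w \<in> N"
        "\<And>c v. v \<in> N \<Longrightarrow> ap (const c) v \<in> N" "\<And>x v. v \<in> N \<Longrightarrow> ap (gen x) v \<in> N"
        using that by (auto simp: submodule_iff_invariant)
      have "omega_invariant lam \<alpha> (\<phi> ` N)"
        unfolding omega_invariant_def
        using N by (auto simp: image_iff subset_iff simp flip: zero add scale act)
      moreover have "\<phi> ` N \<noteq> UNIV"
        using \<open>N \<noteq> carrier M\<close> N(1) bij_betw_imp_inj_on[OF bij] bij_betw_imp_surj_on[OF bij]
        by (metis inj_on_image_eq_iff order_refl)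
      ultimately have "\<phi> v = 0" if "v \<in> N" for v
        using omega_invariant_UNIV[of lam \<alpha> "\<phi> ` N" "\<phi> v"] assms(2) \<open>\<alpha> \<noteq> 0\<close> that by blast
      then show "N = {\<zero>\<^bsub>M\<^esub>}" using N(1,2) eq_zero by blast
    qed
    moreover have "carrier M \<noteq> {\<zero>\<^bsub>M\<^esub>}"
    proof
      assume "carrier M = {\<zero>\<^bsub>M\<^esub>}"
      then have "UNIV = {0 :: complex poly}"
        using bij_betw_imp_surj_on[OF bij] zero by simp
      then show False by (metis UNIV_I singletonD one_neq_zero)
    qed
    ultimately show "simple_module (W22.enveloping UNIV) M"
      using M by (simp add: simple_module_def)
  qed
qed

text \<open>A basis vector b identifies C[t] with \<open>M\<close> by p -> p(L_0) b. The action
  pulled back to C[t] has L_0 acting as t, so \<open>omega_classification\<close> applies.\<close>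

lemma omega_iso_exists:
  fixes M :: "((w22 word \<Rightarrow>\<^sub>0 complex) set, 'm) module"
  assumes M: "left_module (W22.enveloping UNIV) M"
    and free: "free_of_rank_one (W22.enveloping (W22.span {w22_basis (L 0)}))
           (restrict_scalars (W22.enveloping_inclusion UNIV) M)"
  obtains lam \<alpha> where "lam \<noteq> 0" "lie_rep_iso (W22.underlying_rep M) (Omega lam \<alpha>)"
proof -
  interpret enveloping_module w22_scale w22_bracket M
    by (intro enveloping_module.intro W22.lie_algebra_axioms M)
  have "w22_basis (L 0) \<noteq> 0"
    by (metis lookup_single_eq lookup_zero zero_neq_one)
  then obtain b where b: "b \<in> carrier M"
    and bij: "bij_betw (\<lambda>p. ap (poly_gen (w22_basis (L 0)) p) b) UNIV (carrier M)"
    using free by (rule free_of_rank_one_line)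
  define \<psi> where "\<psi> = (\<lambda>p. ap (poly_gen (w22_basis (L 0)) p) b)"
  define \<phi> where "\<phi> = inv_into UNIV \<psi>"
  have \<psi>_closed: "\<psi> p \<in> carrier M" for p using b by (simp add: \<psi>_def ap_closed)
  have inj: "inj \<psi>" and range: "range \<psi> = carrier M"
    using bij by (auto simp: bij_betw_def \<psi>_def)
  have \<psi>\<phi>: "\<psi> (\<phi> v) = v" if "v \<in> carrier M" for v
    using that range unfolding \<phi>_def by (metis f_inv_into_f)
  have \<phi>\<psi>: "\<phi> (\<psi> p) = p" for p using inj by (simp add: \<phi>_def)
  have \<psi>_add: "\<psi> (p + q) = \<psi> p \<oplus>\<^bsub>M\<^esub> \<psi> q" for p q
    using b by (simp add: \<psi>_def poly_gen_add ap_add_left)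
  have \<psi>_scale: "\<psi> (Polynomial.smult c p) = ap (const c) (\<psi> p)" for c p
    using b by (simp add: \<psi>_def poly_gen_smult ap_mult)
  have \<psi>_pCons: "\<psi> (pCons 0 p) = ap (gen (w22_basis (L 0))) (\<psi> p)" for p
    using b by (simp add: \<psi>_def poly_gen_pCons const_simps ap_mult)
  define A where "A = (\<lambda>x p. \<phi> (ap (gen x) (\<psi> p)))"
  have \<psi>_A: "\<psi> (A x p) = ap (gen x) (\<psi> p)" for x p
    by (simp add: A_def \<psi>\<phi> ap_closed \<psi>_closed)
  obtain lam \<alpha> where lam: "lam \<noteq> 0" and A: "\<And>x p. A x p = act (Omega lam \<alpha>) x p"
  proof (rule omega_classification[of A])
    \<comment> \<open>Each law is checked in \<open>M\<close> after applying the injective \<psi>,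
      which turns \<open>A x\<close> into the action of \<open>x\<close>.\<close>
    show "A (x + y) p = A x p + A y p" for x y p
      by (rule injD[OF inj]) (simp add: \<psi>_A \<psi>_add ap_gen_add \<psi>_closed)
    show "A (w22_scale c x) p = Polynomial.smult c (A x p)" for c x p
      by (rule injD[OF inj]) (simp add: \<psi>_A \<psi>_scale ap_gen_scale \<psi>_closed)
    show "A x (p + q) = A x p + A x q" for x p q
      by (rule injD[OF inj]) (simp add: \<psi>_A \<psi>_add ap_add_right \<psi>_closed)
    show "A x (Polynomial.smult c p) = Polynomial.smult c (A x p)" for x c p
      by (rule injD[OF inj]) (simp add: \<psi>_A \<psi>_scale ap_const_gen \<psi>_closed)
    have "A (w22_bracket x y) p + A y (A x p) = A x (A y p)" for x y p
      by (rule injD[OF inj]) (simp add: \<psi>_A \<psi>_add ap_gen_bracket \<psi>_closed)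
    then show "A (w22_bracket x y) p = A x (A y p) - A y (A x p)" for x y p
      by (simp add: eq_diff_eq)
    show "A (w22_basis (L 0)) p = pCons 0 p" for p
      by (rule injD[OF inj]) (simp add: \<psi>_A \<psi>_pCons)
  qed blast
  have "lie_rep_iso (W22.underlying_rep M) (Omega lam \<alpha>)"
    unfolding lie_rep_iso_def underlying_rep_simps Omega_simps
  proof (intro exI[of _ \<phi>] conjI ballI allI)
    show "bij_betw \<phi> (carrier M) UNIV"
      unfolding \<phi>_def range[symmetric] using inj by (simp add: bij_betw_inv_into inj_imp_bij_betw_inv)
    fix v assume v: "v \<in> carrier M"
    show "\<phi> (v \<oplus>\<^bsub>M\<^esub> w) = \<phi> v + \<phi> w" if "w \<in> carrier M" for w
      by (rule injD[OF inj]) (simp add: \<psi>\<phi> \<psi>_add v that)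
    show "\<phi> (ap (const c) v) = Polynomial.smult c (\<phi> v)" for c
      by (rule injD[OF inj]) (simp add: \<psi>\<phi> \<psi>_scale v ap_closed)
    show "\<phi> (ap (gen x) v) = act (Omega lam \<alpha>) x (\<phi> v)" for x
      by (rule injD[OF inj]) (simp add: \<psi>\<phi> \<psi>_A v ap_closed flip: A)
  qed
  with lam show thesis by (rule that)
qed

theorem theorem3:
  fixes M :: "((w22 word \<Rightarrow>\<^sub>0 complex) set, 'm) module"
  assumes "left_module (W22.enveloping UNIV) M"
    and "free_of_rank_one (W22.enveloping (W22.span {w22_basis (L 0)}))
           (restrict_scalars (W22.enveloping_inclusion UNIV) M)"
  shows "(\<exists>\<alpha> lam. lam \<noteq> 0 \<and> lie_rep_iso (W22.underlying_rep M) (Omega lam \<alpha>)) \<and>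
    (simple_module (W22.enveloping UNIV) M \<longleftrightarrow>
      (\<exists>\<alpha> lam. lam \<noteq> 0 \<and> \<alpha> \<noteq> 0 \<and> lie_rep_iso (W22.underlying_rep M) (Omega lam \<alpha>)))"
  using omega_iso_exists[OF assms] simple_iff_omega[OF assms(1)] by metis

end
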